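(* Let $\beta>0$ be a fixed constant and let $\gamma\in(0,1]$. For each $n\ge 2$ let $a_1=a_1(n)$ and $a_2=a_2(n)$ satisfy $a_1,a_2>\frac{\beta}{2}(n-1)$, and let $\lambda_1,\dots,\lambda_n$ be random variables with the $\beta$-Jacobi joint density $f_{\beta,a_1,a_2}(\lambda)$ on $[0,1]^n$. Given an integer $k\ge1$, define for $i\ge 1$ $$X_i=\sum_{j=1}^n\left(\frac{c\,a_2}{n}\lambda_j\right)^i-n\sum_{r=0}^{i-1}\frac{1}{r+1}\binom{i}{r}\binom{i-1}{r}\gamma^r,\qquad c=\frac{2\gamma}{\beta}.$$ Assume that $n\to\infty$, $a_1\to\infty$ and $a_2\to\infty$ in such a way that $a_1=o(\sqrt{a_2})$, $n=o(\sqrt{a_2})$ and $\frac{n\beta}{2a_1}\to\gamma$. Then $(X_1,\dots,X_k)$ converges weakly to a multivariate normal distribution $N_k(\mu,\Sigma)$, where $\mu$ and $\Sigma$ are the mean vector and covariance matrix of the limiting normal distribution in the central limit theorem for the $\beta$-Laguerre ensemble described in the context.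
   Context: The $\beta$-Jacobi ensemble with parameters $a_1,a_2>\frac{\beta}{2}(n-1)$ has density on $[0,1]^n$ $$f_{\beta,a_1,a_2}(\lambda)=c_J^{\beta,a_1,a_2}\prod_{1\le i<j\le n}|\lambda_i-\lambda_j|^\beta\prod_{i=1}^n\lambda_i^{a_1-p}(1-\lambda_i)^{a_2-p},\qquad p=1+\tfrac{\beta}{2}(n-1),$$ with normalizing constant $$c_J^{\beta,a_1,a_2}=\prod_{j=1}^n\frac{\Gamma(1+\frac\beta2)\Gamma(a_1+a_2-\frac\beta2(n-j))}{\Gamma(1+\frac\beta2 j)\Gamma(a_1-\frac\beta2(n-j))\Gamma(a_2-\frac\beta2(n-j))}.$$ The parameters $\mu,\Sigma$ are those of a known central limit theorem (Theorem 1.5 of Dumitriu and Edelman's paper on global spectrum fluctuations for $\beta$-ensembles), recalled by the paper in this form: let $\theta_1,\dots,\theta_n$ have the $\beta$-Laguerre density on $[0,\infty)^n$, proportional to $\prod_{i<j}|\theta_i-\theta_j|^\beta\prod_{i}\theta_i^{a-p}e^{-\frac12\sum_i\theta_i}$ with $a>\frac\beta2(n-1)$, and put $$Y_i=\sum_{j=1}^n\Big(\frac{\gamma}{n\beta}\theta_j\Big)^i-n\sum_{r=0}^{i-1}\frac1{r+1}\binom ir\binom{i-1}r\gamma^r.$$ If $n\beta/(2a)\to\gamma\le 1$, then as $n\to\infty$, $(Y_1,\dots,Y_k)$ converges weakly to $N_k(\mu,\Sigma)$.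
   Formalization: The recalled Laguerre CLT fails for some a with nβ/(2a)→γ, since E Y_1 = n(2aγ/(nβ)−1) may diverge (e.g. β=2, γ=1/2, a=2n+√n). So it is assumed that (Y_1,…,Y_k) with a=a_1(n) converges weakly to N_k(μ,Σ), and these are the μ, Σ of the conclusion. *)

theory Defs
  imports "HOL-Probability.Probability" "HOL-Library.Landau_Symbols"
begin

definition weakly_converges ::
    "(nat \<Rightarrow> 'a::metric_space measure) \<Rightarrow> 'a measure \<Rightarrow> bool" where
  "weakly_converges L N \<longleftrightarrow>
     (\<forall>f :: 'a \<Rightarrow> real. continuous_on UNIV f \<and> bounded (range f) \<longrightarrow>
        (\<lambda>n. integral\<^sup>L (L n) f) \<longlonglongrightarrow> integral\<^sup>L N f)"

definition std_normal_vector :: "(real ^ 'k) measure" where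
  "std_normal_vector =
     density lborel (\<lambda>z. ennreal (\<Prod>l\<in>UNIV. std_normal_density (z $ l)))"

text \<open>The law of \<open>\<mu> + A Z\<close> with \<open>Z\<close> standard normal and \<open>A A\<^sup>T = \<Sigma>\<close>.  This law does not depend on
  the choice of \<open>A\<close>; singular covariance matrices are allowed.\<close>

definition multivariate_normal ::
    "real ^ 'k \<Rightarrow> real ^ 'k ^ 'k \<Rightarrow> (real ^ 'k) measure \<Rightarrow> bool" where
  "multivariate_normal \<mu> \<Sigma> N \<longleftrightarrow>
     (\<exists>A :: real ^ 'k ^ 'k. \<Sigma> = A ** transpose A \<and>
        N = distr std_normal_vector borel (\<lambda>z. \<mu> + A *v z))"

definition converges_to_normal ::
    "(nat \<Rightarrow> (real ^ 'k) measure) \<Rightarrow> real ^ 'k \<Rightarrow> real ^ 'k ^ 'k \<Rightarrow> bool" where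
  "converges_to_normal L \<mu> \<Sigma> \<longleftrightarrow> (\<exists>N. multivariate_normal \<mu> \<Sigma> N \<and> weakly_converges L N)"

text \<open>Points of \<open>\<real>\<^sup>n\<close>, for \<open>n\<close> varying, are functions on \<open>{1..n}\<close>, with Lebesgue measure
  \<open>lebesgue_n n\<close>.\<close>

abbreviation lebesgue_n :: "nat \<Rightarrow> (nat \<Rightarrow> real) measure" where
  "lebesgue_n n \<equiv> PiM {1..n} (\<lambda>_. lborel)"

definition vandermonde_abs :: "real \<Rightarrow> nat \<Rightarrow> (nat \<Rightarrow> real) \<Rightarrow> real" where
  "vandermonde_abs \<beta> n x = (\<Prod>j\<in>{1..n}. \<Prod>i\<in>{1..<j}. \<bar>x i - x j\<bar> powr \<beta>)"

definition ens_p :: "real \<Rightarrow> nat \<Rightarrow> real" where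
  "ens_p \<beta> n = 1 + \<beta> / 2 * (real n - 1)"

definition jacobi_const :: "real \<Rightarrow> real \<Rightarrow> real \<Rightarrow> nat \<Rightarrow> real" where
  "jacobi_const \<beta> a1 a2 n =
     (\<Prod>j\<in>{1..n}.
        (Gamma (1 + \<beta> / 2) * Gamma (a1 + a2 - \<beta> / 2 * (real n - real j))) /
        (Gamma (1 + \<beta> / 2 * real j) * Gamma (a1 - \<beta> / 2 * (real n - real j)) *
         Gamma (a2 - \<beta> / 2 * (real n - real j))))"

definition jacobi_density :: "real \<Rightarrow> real \<Rightarrow> real \<Rightarrow> nat \<Rightarrow> (nat \<Rightarrow> real) \<Rightarrow> real" where
  "jacobi_density \<beta> a1 a2 n x =
     (if \<forall>i\<in>{1..n}. 0 \<le> x i \<and> x i \<le> 1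
      then jacobi_const \<beta> a1 a2 n * vandermonde_abs \<beta> n x *
           (\<Prod>i\<in>{1..n}. x i powr (a1 - ens_p \<beta> n) * (1 - x i) powr (a2 - ens_p \<beta> n))
      else 0)"

definition laguerre_weight :: "real \<Rightarrow> real \<Rightarrow> nat \<Rightarrow> (nat \<Rightarrow> real) \<Rightarrow> real" where
  "laguerre_weight \<beta> a n x =
     (if \<forall>i\<in>{1..n}. 0 \<le> x i
      then vandermonde_abs \<beta> n x * (\<Prod>i\<in>{1..n}. x i powr (a - ens_p \<beta> n)) *
           exp (- (1 / 2) * (\<Sum>i\<in>{1..n}. x i))
      else 0)"

definition laguerre_ensemble :: "real \<Rightarrow> real \<Rightarrow> nat \<Rightarrow> (nat \<Rightarrow> real) measure" where
  "laguerre_ensemble \<beta> a n =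
     density (lebesgue_n n)
       (\<lambda>x. ennreal (laguerre_weight \<beta> a n x) /
            (\<integral>\<^sup>+ y. ennreal (laguerre_weight \<beta> a n y) \<partial>lebesgue_n n))"

definition centred_power_sum ::
    "real \<Rightarrow> real \<Rightarrow> nat \<Rightarrow> (nat \<Rightarrow> real) \<Rightarrow> nat \<Rightarrow> real" where
  "centred_power_sum \<gamma> s n x i =
     (\<Sum>j\<in>{1..n}. (s * x j) ^ i) -
     real n * (\<Sum>r\<in>{0..i - 1}. 1 / (real r + 1) * real (i choose r) * real ((i - 1) choose r) * \<gamma> ^ r)"

text \<open>The vector \<open>(S\<^sub>1, \<dots>, S\<^sub>k)\<close>, \<open>k = CARD('k)\<close>, of centred power sums of \<open>s x\<^sub>1, \<dots>, s x\<^sub>n\<close>; the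
  bijection \<open>e\<close> from the index type onto \<open>{1..k}\<close> says which coordinate is the \<open>i\<close>-th one.\<close>

definition centred_power_sums ::
    "('k \<Rightarrow> nat) \<Rightarrow> real \<Rightarrow> real \<Rightarrow> nat \<Rightarrow> (nat \<Rightarrow> real) \<Rightarrow> real ^ 'k" where
  "centred_power_sums e \<gamma> s n x = (\<chi> l. centred_power_sum \<gamma> s n x (e l))"

text \<open>\<open>\<mu>\<close> and \<open>\<Sigma>\<close> are the parameters of the limiting normal distribution in the central limit theorem
  for the \<open>\<beta>\<close>-Laguerre ensembles with parameters \<open>a n\<close>.  The limit is taken along the given sequence \<open>a\<close>,
  not along all sequences with \<open>n \<beta> / (2 a n) \<longrightarrow> \<gamma>\<close>: the expectation of the first centred power sum is
  \<open>n (2 \<gamma> a n / (n \<beta>) - 1)\<close>, so no \<open>\<mu>\<close> serves all of these sequences at once.\<close>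

definition laguerre_clt_parameters ::
    "('k \<Rightarrow> nat) \<Rightarrow> real \<Rightarrow> real \<Rightarrow> (nat \<Rightarrow> real) \<Rightarrow> real ^ 'k \<Rightarrow> real ^ 'k ^ 'k \<Rightarrow> bool" where
  "laguerre_clt_parameters e \<beta> \<gamma> a \<mu> \<Sigma> \<longleftrightarrow>
     converges_to_normal
       (\<lambda>n. distr (laguerre_ensemble \<beta> (a n) n) borel
              (centred_power_sums e \<gamma> (\<gamma> / (real n * \<beta>)) n)) \<mu> \<Sigma>"

end

theory Submission
  imports Defs
begin

text \<open>
  Suppose that \<open>\<theta>\<^sub>1, \<dots>, \<theta>\<^sub>n\<close> follow the Laguerre ensemble with parameter \<open>a1\<close>.  The Jacobi ensemble is, up to
  an error that vanishes in total variation, the image of this law under a coordinatewise map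
  \<open>\<theta> \<mapsto> \<lambda>\<close> with \<open>2 a2 \<lambda>\<close> close to \<open>\<theta>\<close>.  Since \<open>c a2 / n = (\<gamma> / (n \<beta>)) 2 a2\<close>, the centred power sums
  of the two ensembles then have the same limit.

  With the plain choice \<open>\<lambda> = \<theta> / (2 a2)\<close> the density ratio contains, to leading order, the factor
  \<open>exp (- \<Sum>\<theta>\<^sub>i\<^sup>2 / (8 a2))\<close>, whose exponent has mean of order \<open>n\<^sup>3 / a2\<close>; this need not be
  small, and one would have to control the fluctuations of \<open>\<Sum>\<theta>\<^sub>i\<^sup>2\<close> and the normalizing
  constants.  A Moebius map avoids both.  Put
  \<open>A = a2 - p\<close>, \<open>B = a1 + a2\<close>, \<open>r = \<surd>(A / B)\<close>, \<open>v = \<theta> / (2 (A + B r))\<close> and \<open>\<lambda> = (1 + r) v / (1 + r v)\<close>.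
  Differences transform by \<open>\<lambda>\<^sub>i - \<lambda>\<^sub>j = (1 + r) (v\<^sub>i - v\<^sub>j) / ((1 + r v\<^sub>i) (1 + r v\<^sub>j))\<close>, so that the Vandermonde
  factor is preserved up to a product over the coordinates, and the Jacobi density becomes a constant
  times the Laguerre density times \<open>\<Prod> l(v\<^sub>i)\<close> with
  \<open>l(v) = (1 - v)\<^sup>A (1 + r v)\<^sup>-\<^sup>B exp ((A + B r) v)\<close>.  The value of \<open>r\<close> is the one for which the quadratic
  term of \<open>ln l\<close> vanishes, and for \<open>A \<ge> 4\<close> it gives \<open>0 \<le> l \<le> 1\<close> and \<open>1 - l(v) \<le> 2 A v\<^sup>3\<close>
  (\<open>tilt_factor_bounds\<close>).  A tilt by a function with values in \<open>[0, 1]\<close> moves the expectation of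
  a quantity bounded by \<open>1\<close> by at most twice the mean of one minus that function (\<open>tilted_expectation\<close>), whatever the constant, so the error
  is of order \<open>E \<Sum>\<theta>\<^sub>i\<^sup>3 / a2\<^sup>2 = O((n\<^sup>2 / a2)\<^sup>2)\<close>.

  What remains is the moment bound \<open>E \<Sum>\<theta>\<^sub>i\<^sup>m = O(n\<^sup>m\<^sup>+\<^sup>1)\<close> for the Laguerre ensemble (\<open>moment_bound\<close>).
  Substituting \<open>x \<mapsto> T x\<close> in every coordinate of the partition function, for a contraction \<open>T\<close> of
  \<open>[0, \<infinity>)\<close>, yields \<open>E exp G \<le> 1\<close> and hence \<open>E G \<le> 0\<close>, where \<open>G\<close> collects the gain
  \<open>\<Sum>(\<theta>\<^sub>i - T \<theta>\<^sub>i) / 2\<close> in the exponential weight and the losses in the other factors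
  (\<open>contraction_exponential_bound\<close>).  The choice
  \<open>T x = x (1 + t x\<^sup>m)\<^bsup>-1/m\<^esup>\<close> with \<open>t \<rightarrow> 0\<close> bounds the moment of order \<open>m + 1\<close> by \<open>O(n)\<close> times the
  moment of order \<open>m\<close>; this is the inequality part of a loop equation, obtained without any integration by
  parts across the singularities of the density.

  The same moments show that replacing \<open>2 a2 \<lambda>\<close> by \<open>\<theta>\<close> changes the power sums by \<open>O(n\<^sup>2 / a2)\<close> in mean
  (\<open>centred_power_sums_close\<close>), and Slutsky's theorem (\<open>weakly_converges_distr_perturb\<close>) finishes the
  proof.
\<close>

text \<open>Index sets are written \<open>{1..n}\<close> throughout, and the rewriting of \<open>1\<close> to \<open>Suc 0\<close> would hide them.\<close>

declare One_nat_def [simp del]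

section \<open>Elementary inequalities\<close>

lemma ln_one_minus_upper:
  fixes v :: real
  assumes "0 \<le> v" "v < 1"
  shows "ln (1 - v) + v + v\<^sup>2 / 2 \<le> 0"
proof -
  let ?f = "\<lambda>v::real. - (ln (1 - v) + v + v\<^sup>2 / 2)"
  have "?f 0 \<le> ?f v"
  proof (rule DERIV_nonneg_imp_nondecreasing[OF assms(1)])
    fix x assume x: "0 \<le> x" "x \<le> v"
    have "(?f has_real_derivative (1 / (1 - x) - 1 - x)) (at x)"
      using x assms by (auto intro!: derivative_eq_intros)
    moreover have "0 \<le> 1 / (1 - x) - 1 - x"
      using x assms by (simp add: field_simps)
    ultimately show "\<exists>y. (?f has_real_derivative y) (at x) \<and> 0 \<le> y" by blast
  qed
  then show ?thesis by simp
qed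

lemma ln_one_minus_lower:
  fixes v :: real
  assumes "0 \<le> v" "v \<le> 1/2"
  shows "0 \<le> ln (1 - v) + v + v\<^sup>2 / 2 + v ^ 3"
proof -
  let ?f = "\<lambda>v::real. ln (1 - v) + v + v\<^sup>2 / 2 + v ^ 3"
  have "?f 0 \<le> ?f v"
  proof (rule DERIV_nonneg_imp_nondecreasing[OF assms(1)])
    fix x assume x: "0 \<le> x" "x \<le> v"
    have "(?f has_real_derivative (- (1 / (1 - x)) + 1 + x + 3 * x\<^sup>2)) (at x)"
      using x assms by (auto intro!: derivative_eq_intros)
    moreover have eq: "- (1 / (1 - x)) + 1 + x + 3 * x\<^sup>2 = x\<^sup>2 * (2 - 3 * x) / (1 - x)"
      using x assms by (simp add: field_simps power2_eq_square)
    moreover have "0 \<le> x\<^sup>2 * (2 - 3 * x) / (1 - x)"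
      using x assms by (intro divide_nonneg_nonneg mult_nonneg_nonneg) auto
    ultimately show "\<exists>y. (?f has_real_derivative y) (at x) \<and> 0 \<le> y" unfolding eq by blast
  qed
  then show ?thesis by simp
qed

lemma ln_one_plus_lower:
  fixes w :: real
  assumes "0 \<le> w"
  shows "w - w\<^sup>2 / 2 \<le> ln (1 + w)"
proof -
  let ?f = "\<lambda>w::real. ln (1 + w) - w + w\<^sup>2 / 2"
  have "?f 0 \<le> ?f w"
  proof (rule DERIV_nonneg_imp_nondecreasing[OF assms(1)])
    fix x assume x: "0 \<le> x" "x \<le> w"
    have "(?f has_real_derivative (1 / (1 + x) - 1 + x)) (at x)"
      using x assms by (auto intro!: derivative_eq_intros)
    moreover have "0 \<le> 1 / (1 + x) - 1 + x"
      using x assms by (simp add: field_simps)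
    ultimately show "\<exists>y. (?f has_real_derivative y) (at x) \<and> 0 \<le> y" by blast
  qed
  then show ?thesis by simp
qed

lemma ln_one_plus_upper:
  fixes w :: real
  assumes "0 \<le> w"
  shows "ln (1 + w) \<le> w - w\<^sup>2 / 2 + w ^ 3 / 3"
proof -
  let ?f = "\<lambda>w::real. w - w\<^sup>2 / 2 + w ^ 3 / 3 - ln (1 + w)"
  have "?f 0 \<le> ?f w"
  proof (rule DERIV_nonneg_imp_nondecreasing[OF assms(1)])
    fix x assume x: "0 \<le> x" "x \<le> w"
    have "(?f has_real_derivative (1 - x + x\<^sup>2 - 1 / (1 + x))) (at x)"
      using x assms by (auto intro!: derivative_eq_intros)
    moreover have eq: "1 - x + x\<^sup>2 - 1 / (1 + x) = x ^ 3 / (1 + x)"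
      using x assms by (simp add: field_simps power2_eq_square power3_eq_cube)
    moreover have "0 \<le> x ^ 3 / (1 + x)"
      using x assms by (intro divide_nonneg_nonneg) auto
    ultimately show "\<exists>y. (?f has_real_derivative y) (at x) \<and> 0 \<le> y" unfolding eq by blast
  qed
  then show ?thesis by simp
qed

lemma one_plus_powr_neg_le:
  fixes z \<alpha> :: real
  assumes "0 \<le> z" "0 < \<alpha>" "\<alpha> \<le> 1"
  shows "(1 + z) powr (- \<alpha>) \<le> 1 - \<alpha> * z + z\<^sup>2"
proof -
  have "(1 / (1 + z)) powr \<alpha> * 1 powr (1 - \<alpha>) \<le> \<alpha> * (1 / (1 + z)) + (1 - \<alpha>) * 1"
    using assms by (intro Youngs_inequality_0) auto
  then have "(1 + z) powr (- \<alpha>) \<le> 1 - \<alpha> + \<alpha> / (1 + z)"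
    using assms by (simp add: powr_divide powr_minus_divide)
  also have "1 / (1 + z) \<le> 1 - z + z\<^sup>2"
    using assms by (simp add: field_simps power2_eq_square)
  then have "\<alpha> * (1 / (1 + z)) \<le> \<alpha> * (1 - z + z\<^sup>2)"
    using assms by (intro mult_left_mono) auto
  then have "1 - \<alpha> + \<alpha> / (1 + z) \<le> 1 - \<alpha> * z + \<alpha> * z\<^sup>2"
    by (simp add: algebra_simps)
  also have "\<dots> \<le> 1 - \<alpha> * z + z\<^sup>2"
    using assms mult_right_mono[of \<alpha> 1 "z\<^sup>2"] by simp
  finally show ?thesis .
qed

section \<open>Coordinatewise substitution\<close>

interpretation lebesgue_product: product_sigma_finite "\<lambda>_::nat. lborel :: real measure"
  by standard

text \<open>By Fubini and induction on the number of coordinates, this reduces to the substitution rule on an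
  interval.  Measurability of \<open>g\<close> and \<open>g'\<close> on the whole line keeps all iterated integrands measurable.\<close>

lemma nn_integral_PiM_substitution:
  fixes g g' :: "real \<Rightarrow> real"
  assumes "finite I" and b: "0 < b"
    and der: "\<And>x. x \<in> {0..b} \<Longrightarrow> (g has_real_derivative g' x) (at x)"
    and cont: "continuous_on {0..b} g'"
    and nonneg: "\<And>x. x \<in> {0..b} \<Longrightarrow> 0 \<le> g' x"
    and [measurable]: "g \<in> borel_measurable borel" "g' \<in> borel_measurable borel"
    and "f \<in> borel_measurable (PiM I (\<lambda>_::nat. lborel))"
  shows "(\<integral>\<^sup>+ x. f x * (\<Prod>i\<in>I. indicator {g 0..g b} (x i)) \<partial>PiM I (\<lambda>_. lborel)) =
         (\<integral>\<^sup>+ x. f (\<lambda>i\<in>I. g (x i)) * (\<Prod>i\<in>I. ennreal (g' (x i)) * indicator {0..b} (x i)) \<partial>PiM I (\<lambda>_. lborel))"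
  using \<open>finite I\<close> assms(8)
proof (induction I arbitrary: f rule: finite_induct)
  case empty
  then show ?case
    by (simp add: nn_integral_count_space_finite PiM_empty restrict_def)
next
  case (insert i I)
  note [measurable] = insert.prems
  have upd: "(\<lambda>j\<in>insert i I. g ((x(i := y)) j)) = (\<lambda>j\<in>I. g (x j))(i := g y)" for x y
    by (auto simp: fun_eq_iff)
  have upd_prod: "(\<Prod>j\<in>insert i I. h ((x(i := y)) j)) = h y * (\<Prod>j\<in>I. h (x j))"
    for h :: "real \<Rightarrow> ennreal" and x y
  proof -
    have "(\<Prod>j\<in>I. h ((x(i := y)) j)) = (\<Prod>j\<in>I. h (x j))"
      using insert.hyps by (intro prod.cong) auto
    then show ?thesis using insert.hyps by simp
  qed
  have one_dim: "(\<integral>\<^sup>+ y. h y * indicator {g 0..g b} y \<partial>lborel) =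
      (\<integral>\<^sup>+ y. h (g y) * ennreal (g' y) * indicator {0..b} y \<partial>lborel)"
    if [measurable]: "h \<in> borel_measurable borel" for h
    using der cont nonneg b by (intro nn_integral_substitution_aux) auto
  have "(\<integral>\<^sup>+ x. f x * (\<Prod>j\<in>insert i I. indicator {g 0..g b} (x j)) \<partial>PiM (insert i I) (\<lambda>_. lborel)) =
      (\<integral>\<^sup>+ x. (\<integral>\<^sup>+ y. f (x(i := y)) * (\<Prod>j\<in>insert i I. indicator {g 0..g b} ((x(i := y)) j)) \<partial>lborel)
         \<partial>PiM I (\<lambda>_. lborel))"
    using insert.hyps by (intro lebesgue_product.product_nn_integral_insert) auto
  also have "\<dots> = (\<integral>\<^sup>+ x. (\<integral>\<^sup>+ y. f (x(i := y)) * indicator {g 0..g b} y \<partial>lborel) *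
         (\<Prod>j\<in>I. indicator {g 0..g b} (x j)) \<partial>PiM I (\<lambda>_. lborel))"
    unfolding upd_prod
    by (intro nn_integral_cong, subst nn_integral_multc[symmetric]) (auto simp: mult_ac)
  also have "\<dots> = (\<integral>\<^sup>+ x. (\<integral>\<^sup>+ y. f (x(i := g y)) * ennreal (g' y) * indicator {0..b} y \<partial>lborel) *
         (\<Prod>j\<in>I. indicator {g 0..g b} (x j)) \<partial>PiM I (\<lambda>_. lborel))"
    by (intro nn_integral_cong arg_cong2[where f="(*)"] one_dim) auto
  also have "\<dots> = (\<integral>\<^sup>+ x. (\<integral>\<^sup>+ y. f ((\<lambda>j\<in>I. g (x j))(i := g y)) * ennreal (g' y) * indicator {0..b} y \<partial>lborel) *
         (\<Prod>j\<in>I. ennreal (g' (x j)) * indicator {0..b} (x j)) \<partial>PiM I (\<lambda>_. lborel))"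
    by (intro insert.IH) measurable
  also have "\<dots> = (\<integral>\<^sup>+ x. (\<integral>\<^sup>+ y. f (\<lambda>j\<in>insert i I. g ((x(i := y)) j)) *
         (\<Prod>j\<in>insert i I. ennreal (g' ((x(i := y)) j)) * indicator {0..b} ((x(i := y)) j)) \<partial>lborel)
         \<partial>PiM I (\<lambda>_. lborel))"
    unfolding upd_prod[of "\<lambda>y. ennreal (g' y) * indicator {0..b} y"] upd
    by (intro nn_integral_cong, subst nn_integral_multc[symmetric]) (auto simp: mult_ac)
  also have "\<dots> = (\<integral>\<^sup>+ x. f (\<lambda>j\<in>insert i I. g (x j)) *
         (\<Prod>j\<in>insert i I. ennreal (g' (x j)) * indicator {0..b} (x j)) \<partial>PiM (insert i I) (\<lambda>_. lborel))"
    using insert.hyps by (intro lebesgue_product.product_nn_integral_insert[symmetric]) auto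
  finally show ?case .
qed

section \<open>The Vandermonde factor and the Laguerre weight\<close>

text \<open>Each index occurs in exactly \<open>n - 1\<close> pairs; this is how factors attached to pairs become factors
  attached to single coordinates.\<close>

lemma prod_pairs:
  fixes g :: "nat \<Rightarrow> 'a::comm_monoid_mult"
  shows "(\<Prod>j\<in>{1..n}. \<Prod>i\<in>{1..<j}. g i * g j) = (\<Prod>i\<in>{1..n}. g i ^ (n - 1))"
proof (induction n)
  case (Suc n)
  have "(\<Prod>i\<in>{1..n}. g i * g (Suc n)) = (\<Prod>i\<in>{1..n}. g i) * g (Suc n) ^ n"
    by (simp add: prod.distrib)
  then have "(\<Prod>j\<in>{1..Suc n}. \<Prod>i\<in>{1..<j}. g i * g j) =
      (\<Prod>i\<in>{1..n}. g i ^ (n - 1)) * ((\<Prod>i\<in>{1..n}. g i) * g (Suc n) ^ n)"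
    using Suc.IH by (simp add: atLeastLessThanSuc_atLeastAtMost)
  also have "\<dots> = (\<Prod>i\<in>{1..n}. g i ^ n) * g (Suc n) ^ n"
    unfolding mult.assoc[symmetric] prod.distrib[symmetric]
    by (intro arg_cong2[where f="(*)"] prod.cong refl power_minus_mult) auto
  finally show ?case by simp
qed simp

lemma vandermonde_abs_scaled:
  assumes "\<And>i. i \<in> {1..n} \<Longrightarrow> 0 \<le> g i"
    and "\<And>i j. i \<in> {1..n} \<Longrightarrow> j \<in> {1..n} \<Longrightarrow> i < j \<Longrightarrow> \<bar>y i - y j\<bar> = \<bar>x i - x j\<bar> * (g i * g j)"
  shows "vandermonde_abs \<beta> n y = vandermonde_abs \<beta> n x * (\<Prod>i\<in>{1..n}. (g i powr \<beta>) ^ (n - 1))"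
proof -
  have "vandermonde_abs \<beta> n y =
      (\<Prod>j\<in>{1..n}. \<Prod>i\<in>{1..<j}. \<bar>x i - x j\<bar> powr \<beta> * (g i powr \<beta> * g j powr \<beta>))"
    unfolding vandermonde_abs_def using assms
    by (intro prod.cong refl) (auto simp: powr_mult)
  then show ?thesis
    unfolding prod_pairs[symmetric] by (simp add: prod.distrib vandermonde_abs_def)
qed

lemma vandermonde_abs_ge:
  assumes "0 \<le> \<beta>" and "\<And>i. i \<in> {1..n} \<Longrightarrow> 0 \<le> g i"
    and "\<And>i j. i \<in> {1..n} \<Longrightarrow> j \<in> {1..n} \<Longrightarrow> i < j \<Longrightarrow> \<bar>x i - x j\<bar> * (g i * g j) \<le> \<bar>y i - y j\<bar>"
  shows "vandermonde_abs \<beta> n x * (\<Prod>i\<in>{1..n}. (g i powr \<beta>) ^ (n - 1)) \<le> vandermonde_abs \<beta> n y"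
proof -
  have "(\<Prod>j\<in>{1..n}. \<Prod>i\<in>{1..<j}. \<bar>x i - x j\<bar> powr \<beta> * (g i powr \<beta> * g j powr \<beta>)) \<le>
      vandermonde_abs \<beta> n y"
    unfolding vandermonde_abs_def
  proof (intro prod_mono conjI prod_nonneg ballI)
    fix j i assume ij: "j \<in> {1..n}" "i \<in> {1..<j}"
    then have "\<bar>x i - x j\<bar> powr \<beta> * (g i powr \<beta> * g j powr \<beta>) = (\<bar>x i - x j\<bar> * (g i * g j)) powr \<beta>"
      using assms(2)[of i] assms(2)[of j] by (auto simp: powr_mult)
    also have "\<dots> \<le> \<bar>y i - y j\<bar> powr \<beta>"
      using ij assms(1) assms(2)[of i] assms(2)[of j] assms(3)[of i j] by (intro powr_mono2) auto
    finally show "\<bar>x i - x j\<bar> powr \<beta> * (g i powr \<beta> * g j powr \<beta>) \<le> \<bar>y i - y j\<bar> powr \<beta>" .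
  qed auto
  then show ?thesis
    unfolding prod_pairs[symmetric] by (simp add: prod.distrib vandermonde_abs_def)
qed

lemma vandermonde_abs_nonneg: "0 \<le> vandermonde_abs \<beta> n x"
  unfolding vandermonde_abs_def by (intro prod_nonneg ballI) auto

lemma laguerre_weight_nonneg: "0 \<le> laguerre_weight \<beta> a n x"
  unfolding laguerre_weight_def
  by (auto intro!: mult_nonneg_nonneg vandermonde_abs_nonneg prod_nonneg)

lemma borel_measurable_vandermonde_abs [measurable]:
  "vandermonde_abs \<beta> n \<in> borel_measurable (lebesgue_n n)"
  unfolding vandermonde_abs_def
proof (intro borel_measurable_prod)
  fix i j assume "j \<in> {1..n}" "i \<in> {1..<j}"
  then have [measurable]: "(\<lambda>x. x i) \<in> borel_measurable (lebesgue_n n)"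
     "(\<lambda>x. x j) \<in> borel_measurable (lebesgue_n n)"
    using measurable_component_singleton[of i "{1..n}" "\<lambda>_. lborel :: real measure"]
      measurable_component_singleton[of j "{1..n}" "\<lambda>_. lborel :: real measure"] by auto
  show "(\<lambda>x. \<bar>x i - x j\<bar> powr \<beta>) \<in> borel_measurable (lebesgue_n n)" by measurable
qed

lemma borel_measurable_laguerre_weight [measurable]:
  "laguerre_weight \<beta> a n \<in> borel_measurable (lebesgue_n n)"
  unfolding laguerre_weight_def by measurable

lemma prod_indicator:
  assumes "finite I"
  shows "(\<Prod>i\<in>I. indicator A (x i)) = (if \<forall>i\<in>I. x i \<in> A then 1 else (0::ennreal))"
  using assms by (induction I rule: finite_induct) auto

section \<open>Contractions and the Laguerre ensemble\<close>

text \<open>The definition of \<open>laguerre_ensemble\<close> divides by the total mass of the weight.  That this mass is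
  neither \<open>0\<close> nor \<open>\<infinity>\<close> is equivalent to the ensemble being a probability measure, and that is the form
  in which it is assumed here.\<close>

locale laguerre_prob =
  fixes \<beta> a :: real and n :: nat
  assumes beta_pos: "0 < \<beta>"
    and n_pos: "1 \<le> n"
    and a_large: "\<beta> / 2 * (real n - 1) < a"
    and prob: "prob_space (laguerre_ensemble \<beta> a n)"
begin

abbreviation "Q \<equiv> laguerre_ensemble \<beta> a n"

sublocale prob_space Q
  by (rule prob)

lemma sets_Q [simp, measurable_cong]: "sets Q = sets (lebesgue_n n)"
  by (simp add: laguerre_ensemble_def)

definition partition_function :: ennreal where
  "partition_function = (\<integral>\<^sup>+ y. ennreal (laguerre_weight \<beta> a n y) \<partial>lebesgue_n n)"

lemma partition_function_finite: "partition_function \<noteq> 0" "partition_function \<noteq> \<infinity>"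
proof -
  have "1 = emeasure Q (space Q)" by (simp add: emeasure_space_1)
  also have "\<dots> = (\<integral>\<^sup>+ x. ennreal (laguerre_weight \<beta> a n x) / partition_function \<partial>lebesgue_n n)"
    unfolding laguerre_ensemble_def partition_function_def
    by (subst emeasure_density) (auto intro!: nn_integral_cong)
  also have "\<dots> = partition_function / partition_function"
    unfolding partition_function_def by (rule nn_integral_divide) measurable
  finally have "1 = partition_function / partition_function" .
  then show "partition_function \<noteq> 0" "partition_function \<noteq> \<infinity>"
    by (auto simp: ennreal_divide_top)
qed

lemma nn_integral_Q:
  assumes [measurable]: "F \<in> borel_measurable (lebesgue_n n)"
  shows "(\<integral>\<^sup>+ x. F x \<partial>Q) =
    (\<integral>\<^sup>+ x. ennreal (laguerre_weight \<beta> a n x) * F x \<partial>lebesgue_n n) / partition_function"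
proof -
  have "(\<integral>\<^sup>+ x. F x \<partial>Q) =
     (\<integral>\<^sup>+ x. ennreal (laguerre_weight \<beta> a n x) / partition_function * F x \<partial>lebesgue_n n)"
    unfolding laguerre_ensemble_def partition_function_def by (subst nn_integral_density) auto
  also have "\<dots> = (\<integral>\<^sup>+ x. ennreal (laguerre_weight \<beta> a n x) * F x / partition_function \<partial>lebesgue_n n)"
    by (simp add: divide_ennreal_def mult_ac)
  also have "\<dots> = (\<integral>\<^sup>+ x. ennreal (laguerre_weight \<beta> a n x) * F x \<partial>lebesgue_n n) / partition_function"
    by (rule nn_integral_divide) measurable
  finally show ?thesis .
qed

lemma AE_Q_nonneg: "AE x in Q. \<forall>i\<in>{1..n}. 0 \<le> x i"
  unfolding laguerre_ensemble_def
  by (subst AE_density) (auto simp: laguerre_weight_def)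

text \<open>The substitution \<open>x \<mapsto> T x\<close> in all coordinates can only decrease the partition function, because the
  range of \<open>T\<close> is contained in \<open>[0, \<infinity>)\<close>.  The transformed weight is at least the original weight times
  \<open>exp G\<close>: a pair loses at most \<open>exp (- \<beta> (d x + d y))\<close> in the Vandermonde factor, a coordinate loses at
  most \<open>exp (- c x)\<close> in the power and in the Jacobian together, and the exponential factor gains
  \<open>exp ((x - T x) / 2)\<close>.  The functions \<open>d\<close> and \<open>c\<close> are parameters because two different contractions
  are used below.\<close>

lemma contraction_exponential_bound:
  fixes T T' d c :: "real \<Rightarrow> real"
  assumes [measurable]: "T \<in> borel_measurable borel" "T' \<in> borel_measurable borel"
      "d \<in> borel_measurable borel" "c \<in> borel_measurable borel"
    and der: "\<And>x. 0 \<le> x \<Longrightarrow> (T has_real_derivative T' x) (at x)"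
    and cont: "continuous_on {0..} T'"
    and T'_nonneg: "\<And>x. 0 \<le> x \<Longrightarrow> 0 \<le> T' x"
    and T_0: "T 0 = 0"
    and gap: "\<And>x y. 0 \<le> x \<Longrightarrow> x < y \<Longrightarrow> (y - x) * exp (- (d x + d y)) \<le> T y - T x"
    and weight: "\<And>x. 0 \<le> x \<Longrightarrow>
      x powr (a - ens_p \<beta> n) * exp (- c x) \<le> T x powr (a - ens_p \<beta> n) * T' x"
  shows "(\<integral>\<^sup>+ x. ennreal (exp (\<Sum>i\<in>{1..n}. (x i - T (x i)) / 2 - \<beta> * (real n - 1) * d (x i) - c (x i))) \<partial>Q) \<le> 1"
proof -
  define G where "G x = (\<Sum>i\<in>{1..n}. (x i - T (x i)) / 2 - \<beta> * (real n - 1) * d (x i) - c (x i))"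
    for x :: "nat \<Rightarrow> real"
  have [measurable]: "G \<in> borel_measurable (lebesgue_n n)"
    unfolding G_def by measurable
  have T_nonneg: "0 \<le> T x" if "0 \<le> x" for x
  proof (cases "x = 0")
    case False
    then have "0 \<le> (x - 0) * exp (- (d 0 + d x))" using that by simp
    also have "\<dots> \<le> T x - T 0" using gap[of 0 x] that False by simp
    finally show ?thesis using T_0 by simp
  qed (simp add: T_0)
  have pointwise: "laguerre_weight \<beta> a n x * exp (G x) \<le>
      laguerre_weight \<beta> a n (\<lambda>i\<in>{1..n}. T (x i)) * (\<Prod>i\<in>{1..n}. T' (x i))"
    if x: "\<forall>i\<in>{1..n}. 0 \<le> x i" for x
  proof -
    let ?y = "\<lambda>i\<in>{1..n}. T (x i)"
    have V: "vandermonde_abs \<beta> n x * (\<Prod>i\<in>{1..n}. (exp (- d (x i)) powr \<beta>) ^ (n - 1)) \<le> vandermonde_abs \<beta> n ?y"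
    proof (rule vandermonde_abs_ge)
      fix i j assume ij: "i \<in> {1..n}" "j \<in> {1..n}" "i < j"
      have "\<bar>x i - x j\<bar> * (exp (- d (x i)) * exp (- d (x j))) \<le> \<bar>T (x i) - T (x j)\<bar>"
        using gap[of "x i" "x j"] gap[of "x j" "x i"] x ij
        by (cases "x i" "x j" rule: linorder_cases) (auto simp: exp_add[symmetric] add_ac)
      then show "\<bar>x i - x j\<bar> * (exp (- d (x i)) * exp (- d (x j))) \<le> \<bar>?y i - ?y j\<bar>"
        using ij by simp
    qed (use beta_pos in auto)
    have W: "(\<Prod>i\<in>{1..n}. x i powr (a - ens_p \<beta> n) * exp (- c (x i))) \<le>
        (\<Prod>i\<in>{1..n}. T (x i) powr (a - ens_p \<beta> n) * T' (x i))"
      using x weight by (intro prod_mono) auto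
    have e: "(exp (- d (x i)) powr \<beta>) ^ (n - 1) = exp (- (\<beta> * (real n - 1) * d (x i)))" for i
      using n_pos by (simp add: powr_def exp_of_nat_mult[symmetric] of_nat_diff algebra_simps)
    have "laguerre_weight \<beta> a n x * exp (G x) =
        (vandermonde_abs \<beta> n x * (\<Prod>i\<in>{1..n}. (exp (- d (x i)) powr \<beta>) ^ (n - 1))) *
        (\<Prod>i\<in>{1..n}. x i powr (a - ens_p \<beta> n) * exp (- c (x i))) * exp (- (1/2) * (\<Sum>i\<in>{1..n}. T (x i)))"
      using x unfolding laguerre_weight_def G_def e
      by (simp add: prod.distrib exp_sum[symmetric] exp_add[symmetric] mult_exp_exp sum_subtractf
            sum_negf sum_divide_distrib[symmetric] diff_divide_distrib)
    also have "\<dots> \<le> vandermonde_abs \<beta> n ?y * (\<Prod>i\<in>{1..n}. T (x i) powr (a - ens_p \<beta> n) * T' (x i)) *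
        exp (- (1/2) * (\<Sum>i\<in>{1..n}. T (x i)))"
      by (intro mult_right_mono mult_mono V W vandermonde_abs_nonneg prod_nonneg) auto
    also have "\<dots> = laguerre_weight \<beta> a n ?y * (\<Prod>i\<in>{1..n}. T' (x i))"
      using x T_nonneg unfolding laguerre_weight_def by (simp add: prod.distrib)
    finally show ?thesis .
  qed
  \<comment> \<open>The substitution rule is for bounded intervals, so the bound is first proved on boxes.\<close>
  have box: "(\<integral>\<^sup>+ x. ennreal (laguerre_weight \<beta> a n x * exp (G x)) * (\<Prod>i\<in>{1..n}. indicator {0..b} (x i))
      \<partial>lebesgue_n n) \<le> partition_function" if "0 < b" for b
  proof -
    have "(\<integral>\<^sup>+ x. ennreal (laguerre_weight \<beta> a n x * exp (G x)) * (\<Prod>i\<in>{1..n}. indicator {0..b} (x i)) \<partial>lebesgue_n n) \<le>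
        (\<integral>\<^sup>+ x. ennreal (laguerre_weight \<beta> a n (\<lambda>i\<in>{1..n}. T (x i))) *
            (\<Prod>i\<in>{1..n}. ennreal (T' (x i)) * indicator {0..b} (x i)) \<partial>lebesgue_n n)"
    proof (rule nn_integral_mono)
      fix x :: "nat \<Rightarrow> real"
      show "ennreal (laguerre_weight \<beta> a n x * exp (G x)) * (\<Prod>i\<in>{1..n}. indicator {0..b} (x i)) \<le>
        ennreal (laguerre_weight \<beta> a n (\<lambda>i\<in>{1..n}. T (x i))) *
            (\<Prod>i\<in>{1..n}. ennreal (T' (x i)) * indicator {0..b} (x i))"
      proof (cases "\<forall>i\<in>{1..n}. x i \<in> {0..b}")
        case True
        then have "(\<Prod>i\<in>{1..n}. ennreal (T' (x i))) = ennreal (\<Prod>i\<in>{1..n}. T' (x i))"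
          using T'_nonneg by (intro prod_ennreal) auto
        then show ?thesis
          using pointwise[of x] True
          by (simp add: ennreal_mult'[OF laguerre_weight_nonneg, symmetric] prod.distrib ennreal_leI)
      next
        case False
        then show ?thesis by (auto simp: prod_indicator)
      qed
    qed
    also have "\<dots> = (\<integral>\<^sup>+ x. ennreal (laguerre_weight \<beta> a n x) * (\<Prod>i\<in>{1..n}. indicator {T 0..T b} (x i)) \<partial>lebesgue_n n)"
    proof (rule nn_integral_PiM_substitution[where f = "\<lambda>x. ennreal (laguerre_weight \<beta> a n x)"
            and g = T and g' = T' and b = b and I = "{1..n}", symmetric])
      show "continuous_on {0..b} T'" by (rule continuous_on_subset[OF cont]) auto
      show "(T has_real_derivative T' x) (at x)" "0 \<le> T' x" if "x \<in> {0..b}" for x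
        using that der[of x] T'_nonneg[of x] by simp_all
    qed (use that in measurable)
    also have "\<dots> \<le> partition_function"
      unfolding partition_function_def
    proof (rule nn_integral_mono)
      fix x :: "nat \<Rightarrow> real"
      show "ennreal (laguerre_weight \<beta> a n x) * (\<Prod>i\<in>{1..n}. indicator {T 0..T b} (x i)) \<le> ennreal (laguerre_weight \<beta> a n x)"
        by (auto simp: prod_indicator)
    qed
    finally show ?thesis .
  qed
  let ?F = "\<lambda>k x. ennreal (laguerre_weight \<beta> a n x * exp (G x)) * (\<Prod>i\<in>{1..n}. indicator {0..real (Suc k)} (x i))"
  have "(\<lambda>k. \<integral>\<^sup>+ x. ?F k x \<partial>lebesgue_n n) \<longlonglongrightarrow>
      (\<integral>\<^sup>+ x. ennreal (laguerre_weight \<beta> a n x * exp (G x)) \<partial>lebesgue_n n)"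
  proof (rule nn_integral_LIMSEQ)
    show "incseq ?F"
    proof (intro monoI le_funI mult_left_mono)
      fix k l :: nat and x :: "nat \<Rightarrow> real" assume "k \<le> l"
      then have "x i \<in> {0..real (Suc l)}" if "x i \<in> {0..real (Suc k)}" for i
        using that by auto
      then show "(\<Prod>i\<in>{1..n}. indicator {0..real (Suc k)} (x i)) \<le> (\<Prod>i\<in>{1..n}. indicator {0..real (Suc l)} (x i) :: ennreal)"
        unfolding prod_indicator[OF finite_atLeastAtMost] by (auto split: if_splits)
    qed simp
    show "?F k \<in> borel_measurable (lebesgue_n n)" for k by measurable
    show "(\<lambda>k. ?F k x) \<longlonglongrightarrow> ennreal (laguerre_weight \<beta> a n x * exp (G x))" for x
    proof (cases "\<forall>i\<in>{1..n}. 0 \<le> x i")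
      case False
      then have "laguerre_weight \<beta> a n x = 0" unfolding laguerre_weight_def by auto
      then show ?thesis by simp
    next
      case True
      obtain N where N: "(\<Sum>i\<in>{1..n}. x i) \<le> real N" using real_arch_simple by blast
      have "x i \<le> real (Suc k)" if "N \<le> k" "i \<in> {1..n}" for k i
      proof -
        have "x i \<le> (\<Sum>i\<in>{1..n}. x i)" using True that by (intro member_le_sum) auto
        then show ?thesis using N that by simp
      qed
      then have "?F k x = ennreal (laguerre_weight \<beta> a n x * exp (G x))" if "N \<le> k" for k
        using True that by (subst prod.neutral) auto
      then show ?thesis
        by (intro tendsto_eventually eventually_sequentiallyI[of N])
    qed
  qed
  then have "(\<integral>\<^sup>+ x. ennreal (laguerre_weight \<beta> a n x * exp (G x)) \<partial>lebesgue_n n) \<le> partition_function"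
    using box by (intro LIMSEQ_le_const2) auto
  then have "(\<integral>\<^sup>+ x. ennreal (exp (G x)) \<partial>Q) \<le> partition_function / partition_function"
    by (subst nn_integral_Q)
       (auto simp: ennreal_mult[symmetric] laguerre_weight_nonneg intro!: divide_right_mono_ennreal)
  also have "\<dots> = 1" using partition_function_finite by (simp add: ennreal_divide_self top.not_eq_extremum)
  finally show ?thesis unfolding G_def .
qed

end

section \<open>Moments of the Laguerre ensemble\<close>

lemma power_le_exp:
  fixes z :: real
  assumes "0 \<le> z"
  shows "z ^ m \<le> real m ^ m * exp z"
proof (cases "m = 0")
  case False
  have "z ^ m \<le> (real m * (1 + z / real m)) ^ m"
    using assms False by (intro power_mono) (auto simp: field_simps)
  also have "\<dots> \<le> real m ^ m * exp z"
    unfolding power_mult_distrib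
    using exp_ge_one_plus_x_over_n_power_n[of m z] assms False by (intro mult_left_mono) auto
  finally show ?thesis .
qed (use assms in simp)

text \<open>Jensen's inequality for \<open>exp\<close>, in the form \<open>1 + x \<le> exp x\<close>.\<close>

lemma (in prob_space) expectation_le_0_if_exp_le_1:
  fixes G :: "'a \<Rightarrow> real"
  assumes "integrable M G" and "(\<integral>\<^sup>+ x. ennreal (exp (G x)) \<partial>M) \<le> 1"
  shows "expectation G \<le> 0"
proof -
  have [measurable]: "G \<in> borel_measurable M" using assms(1) by simp
  have int: "integrable M (\<lambda>x. exp (G x))"
    using assms(2) by (intro integrableI_nonneg) (auto simp: top.not_eq_extremum intro: le_less_trans)
  have "ennreal (expectation (\<lambda>x. exp (G x))) \<le> 1"
    using assms(2) int by (subst nn_integral_eq_integral[symmetric]) auto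
  then have "expectation (\<lambda>x. exp (G x)) \<le> 1" by simp
  moreover have "expectation (\<lambda>x. 1 + G x) \<le> expectation (\<lambda>x. exp (G x))"
    using int assms(1) by (intro integral_mono) auto
  ultimately show ?thesis
    using assms(1) by (simp add: prob_space)
qed

text \<open>The first summand of the factor bounds the one in \<open>moment_Suc\<close>; the summand \<open>4\<close> covers the step from
  \<open>0\<close> to \<open>1\<close>, where the first summand vanishes and \<open>moment_1\<close> takes over.\<close>

fun moment_constant :: "real \<Rightarrow> nat \<Rightarrow> real" where
  "moment_constant b 0 = 1"
| "moment_constant b (Suc m) = moment_constant b m * (2 * real m * (2 * b + 1) + 4)"

lemma moment_constant_nonneg: "0 \<le> b \<Longrightarrow> 0 \<le> moment_constant b m"
  by (induction m) auto

context laguerre_prob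
begin

lemma measurable_coordinate:
  "j \<in> {1..n} \<Longrightarrow> (\<lambda>x. x j) \<in> borel_measurable (lebesgue_n n)"
  using measurable_component_singleton[of j "{1..n}" "\<lambda>_. lborel :: real measure"] by auto

lemma measurable_trace [measurable]: "(\<lambda>x. sum x {1..n}) \<in> borel_measurable (lebesgue_n n)"
  by (intro borel_measurable_sum measurable_coordinate)

text \<open>The contraction \<open>x \<mapsto> x / 2\<close>.  The weight is homogeneous apart from its exponential factor, and the
  powers of two add up to \<open>2\<^sup>n\<^sup>a\<close>.  The resulting exponential moment makes all polynomials integrable.\<close>

lemma trace_exponential_moment:
  "(\<integral>\<^sup>+ x. ennreal (exp ((\<Sum>i\<in>{1..n}. x i) / 4 - real n * a * ln 2)) \<partial>Q) \<le> 1"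
proof -
  define c where "c = (a - ens_p \<beta> n + 1) * ln 2"
  have "(\<integral>\<^sup>+ x. ennreal (exp (\<Sum>i\<in>{1..n}. (x i - x i / 2) / 2 - \<beta> * (real n - 1) * (ln 2 / 2) - c)) \<partial>Q) \<le> 1"
  proof (rule contraction_exponential_bound[where T' = "\<lambda>_. 1/2"])
    fix x y :: real assume "0 \<le> x" "x < y"
    have half: "exp (- (ln 2 / 2 + ln 2 / 2)) = (1/2 :: real)" by (simp add: exp_minus)
    show "(y - x) * exp (- (ln 2 / 2 + ln 2 / 2)) \<le> y / 2 - x / 2"
      unfolding half by (simp add: field_simps)
  next
    fix x :: real assume "0 \<le> x"
    have "exp (- c) = (1/2) powr (a - ens_p \<beta> n) * (1/2)"
      by (simp add: c_def powr_def ln_div algebra_simps exp_add exp_diff exp_minus divide_simps)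
    moreover have "(x / 2) powr (a - ens_p \<beta> n) = x powr (a - ens_p \<beta> n) * (1/2) powr (a - ens_p \<beta> n)"
      using \<open>0 \<le> x\<close> powr_mult[of x "1/2" "a - ens_p \<beta> n"] by simp
    ultimately show "x powr (a - ens_p \<beta> n) * exp (- c) \<le> (x / 2) powr (a - ens_p \<beta> n) * (1 / 2)"
      by (simp only: mult.assoc order_refl)
  qed (auto intro!: derivative_eq_intros)
  also have "(\<lambda>x. \<Sum>i\<in>{1..n}. (x i - x i / 2) / 2 - \<beta> * (real n - 1) * (ln 2 / 2) - c) =
      (\<lambda>x. (\<Sum>i\<in>{1..n}. x i) / 4 - real n * a * ln 2)"
    by (simp add: sum_subtractf sum_divide_distrib c_def ens_p_def algebra_simps fun_eq_iff)
  finally show ?thesis .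
qed

lemma integrable_power:
  assumes j: "j \<in> {1..n}"
  shows "integrable Q (\<lambda>x. x j ^ m)"
proof -
  note [measurable] = measurable_coordinate[OF j]
  let ?E = "\<lambda>x::nat \<Rightarrow> real. exp ((\<Sum>i\<in>{1..n}. x i) / 4 - real n * a * ln 2)"
  have "integrable Q ?E"
    using trace_exponential_moment
    by (intro integrableI_nonneg) (auto simp: top.not_eq_extremum intro: le_less_trans)
  then have int: "integrable Q (\<lambda>x. 4 ^ m * (real m ^ m * (exp (real n * a * ln 2) * ?E x)))"
    by simp
  show ?thesis
  proof (rule Bochner_Integration.integrable_bound[OF int])
    show "AE x in Q. norm (x j ^ m) \<le> norm (4 ^ m * (real m ^ m * (exp (real n * a * ln 2) * ?E x)))"
      using AE_Q_nonneg
    proof eventually_elim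
      case (elim x)
      have "x j \<le> (\<Sum>i\<in>{1..n}. x i)" using elim j by (intro member_le_sum) auto
      then have "x j ^ m \<le> (4 * ((\<Sum>i\<in>{1..n}. x i) / 4)) ^ m"
        using elim j by (intro power_mono) auto
      also have "\<dots> = 4 ^ m * ((\<Sum>i\<in>{1..n}. x i) / 4) ^ m" by (rule power_mult_distrib)
      also have "\<dots> \<le> 4 ^ m * (real m ^ m * exp ((\<Sum>i\<in>{1..n}. x i) / 4))"
        using elim by (intro mult_left_mono power_le_exp divide_nonneg_nonneg sum_nonneg) auto
      also have "exp ((\<Sum>i\<in>{1..n}. x i) / 4) = exp (real n * a * ln 2) * ?E x"
        by (simp add: exp_add[symmetric] mult_exp_exp)
      finally show ?case using elim j by simp
    qed
  qed measurable
qed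

lemma integrable_power_sum: "integrable Q (\<lambda>x. \<Sum>i\<in>{1..n}. x i ^ m)"
  by (intro Bochner_Integration.integrable_sum integrable_power)

definition moment :: "nat \<Rightarrow> real" where
  "moment m = expectation (\<lambda>x. \<Sum>i\<in>{1..n}. x i ^ m)"

lemma moment_nonneg: "0 \<le> moment m"
  unfolding moment_def using AE_Q_nonneg
  by (intro integral_nonneg_AE) (auto elim!: eventually_mono intro!: sum_nonneg)

lemma moment_0: "moment 0 = real n"
  by (simp add: moment_def prob_space)

lemma a_pos: "0 < a"
  using a_large beta_pos n_pos by (smt (verit) mult_nonneg_nonneg half_gt_zero of_nat_1 of_nat_mono)

lemma moment_1: "moment 1 \<le> 4 * a * real n"
proof -
  have int: "integrable Q (\<lambda>x. \<Sum>i\<in>{1..n}. x i)"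
    using integrable_power_sum[of 1] by simp
  then have "expectation (\<lambda>x. (\<Sum>i\<in>{1..n}. x i) / 4 - real n * a * ln 2) \<le> 0"
    by (intro expectation_le_0_if_exp_le_1 trace_exponential_moment) auto
  then have "moment 1 \<le> 4 * a * real n * ln 2"
    using int by (simp add: moment_def prob_space mult_ac)
  also have "\<dots> \<le> 4 * a * real n * 1"
    using a_pos ln_2_less_1 by (intro mult_left_mono) auto
  finally show ?thesis by simp
qed

text \<open>The contraction \<open>T x = x (1 + t x\<^sup>m)\<^bsup>-1/m\<^esup>\<close> is the flow of the vector field \<open>- x\<^sup>m\<^sup>+\<^sup>1 / m\<close> at time
  \<open>t\<close>.  It is concave with \<open>T' x = (1 + t x\<^sup>m)\<^bsup>-1/m-1\<^esup>\<close>, so its difference quotients are bounded below by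
  the derivative at the right end point, and every logarithmic loss is at most a multiple of \<open>t x\<^sup>m\<close>.  The
  gain is \<open>t x\<^sup>m\<^sup>+\<^sup>1 / m\<close> up to an error of order \<open>t\<^sup>2\<close>.\<close>

lemma moment_contraction:
  assumes m: "1 \<le> m" and t: "0 < t"
  shows "moment (Suc m) \<le> 2 * real m * (2 * \<beta> * real n + a + 1) * moment m + real m * t * moment (2 * m + 1)"
proof -
  define \<alpha> where "\<alpha> = 1 / real m"
  have \<alpha>: "0 < \<alpha>" "\<alpha> \<le> 1" "\<alpha> * real m = 1"
    using m by (auto simp: \<alpha>_def)
  define q where "q = a - ens_p \<beta> n"
  have q: "0 < q + 1" "q + 1 \<le> a"
    using a_large beta_pos n_pos by (auto simp: q_def ens_p_def)
  define z where "z x = t * x ^ m" for x :: real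
  have z_nonneg: "0 \<le> z x" if "0 \<le> x" for x using that t by (simp add: z_def)
  define T where "T x = x * (1 + z x) powr (- \<alpha>)" for x
  define T' where "T' x = (1 + z x) powr (- \<alpha> - 1)" for x
  define c where "c x = (\<alpha> * (q + 1) + 1) * z x" for x
  have [measurable]: "T \<in> borel_measurable borel" "T' \<in> borel_measurable borel"
      "c \<in> borel_measurable borel" "z \<in> borel_measurable borel"
    unfolding T_def T'_def c_def z_def by measurable
  have der: "(T has_real_derivative T' x) (at x)" if "0 \<le> x" for x
  proof -
    have "((\<lambda>y. 1 + z y) has_real_derivative t * (real m * x ^ (m - 1))) (at x)"
      unfolding z_def by (auto intro!: derivative_eq_intros simp: One_nat_def)
    then have D: "((\<lambda>y. (1 + z y) powr (- \<alpha>)) has_real_derivative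
        - \<alpha> * (1 + z x) powr (- \<alpha> - 1) * (t * (real m * x ^ (m - 1)))) (at x)"
      using z_nonneg[OF that] by (intro DERIV_chain2[OF has_real_derivative_powr]) auto
    have e1: "(1 + z x) powr (- \<alpha>) = (1 + z x) powr (- \<alpha> - 1) * (1 + z x)"
      using z_nonneg[OF that] by (simp add: powr_diff)
    have "x * x ^ (m - 1) = x ^ m" using m by (simp add: power_eq_if)
    then have e2: "x * (\<alpha> * (1 + z x) powr (- \<alpha> - 1) * (t * (real m * x ^ (m - 1)))) =
        (1 + z x) powr (- \<alpha> - 1) * ((\<alpha> * real m) * z x)"
      by (simp add: z_def)
    have "(T has_real_derivative
        (1 + z x) powr (- \<alpha>) - x * (\<alpha> * (1 + z x) powr (- \<alpha> - 1) * (t * (real m * x ^ (m - 1))))) (at x)"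
      unfolding T_def using DERIV_mult[OF DERIV_ident D] by (simp add: mult_ac)
    also have "(1 + z x) powr (- \<alpha>) - x * (\<alpha> * (1 + z x) powr (- \<alpha> - 1) * (t * (real m * x ^ (m - 1)))) = T' x"
      unfolding e1 e2 \<alpha>(3) by (simp add: T'_def algebra_simps)
    finally show ?thesis .
  qed
  have T'_ge: "exp (- (2 * z x + 2 * z y)) \<le> T' w" if "0 \<le> x" "0 \<le> w" "w \<le> y" for x y w
  proof -
    have "z w \<le> z y" using that t by (auto simp: z_def intro!: mult_left_mono power_mono)
    have "(1 + \<alpha>) * ln (1 + z w) \<le> 2 * z w"
      using \<alpha> z_nonneg[OF that(2)] ln_add_one_self_le_self[of "z w"] by (intro mult_mono) auto
    also have "\<dots> \<le> 2 * z x + 2 * z y" using \<open>z w \<le> z y\<close> z_nonneg[OF that(1)] by simp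
    finally show ?thesis
      using z_nonneg[OF that(2)] by (simp add: T'_def powr_def algebra_simps)
  qed
  define G where "G x = (\<Sum>i\<in>{1..n}. (x i - T (x i)) / 2 - \<beta> * (real n - 1) * (2 * z (x i)) - c (x i))"
    for x :: "nat \<Rightarrow> real"
  have "(\<integral>\<^sup>+ x. ennreal (exp (G x)) \<partial>Q) \<le> 1"
    unfolding G_def
  proof (rule contraction_exponential_bound[where T' = T'])
    show "continuous_on {0..} T'"
      unfolding T'_def using z_nonneg
      by (intro continuous_intros) (auto simp: z_def add_nonneg_eq_0_iff intro!: continuous_intros)
    show "T 0 = 0" by (simp add: T_def)
  next
    fix x y :: real assume xy: "0 \<le> x" "x < y"
    obtain w where w: "x < w" "w < y" "T y - T x = (y - x) * T' w"
      using MVT2[of x y T T'] der xy by auto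
    then show "(y - x) * exp (- (2 * z x + 2 * z y)) \<le> T y - T x"
      using T'_ge[of x w y] xy by (auto intro!: mult_left_mono)
  next
    fix x :: real assume x: "0 \<le> x"
    have "(\<alpha> * (q + 1) + 1) * ln (1 + z x) \<le> c x"
      unfolding c_def using \<alpha> q z_nonneg[OF x] ln_add_one_self_le_self[of "z x"]
      by (intro mult_left_mono) auto
    then have "exp (- c x) \<le> exp (- ((\<alpha> * (q + 1) + 1) * ln (1 + z x)))" by simp
    also have "\<dots> = ((1 + z x) powr (- \<alpha>)) powr q * T' x"
      using z_nonneg[OF x] by (simp add: T'_def powr_powr powr_def mult_exp_exp algebra_simps)
    finally have "x powr q * exp (- c x) \<le> x powr q * (((1 + z x) powr (- \<alpha>)) powr q * T' x)"
      by (intro mult_left_mono) auto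
    then show "x powr (a - ens_p \<beta> n) * exp (- c x) \<le> T x powr (a - ens_p \<beta> n) * T' x"
      using x unfolding q_def[symmetric] T_def by (simp add: powr_mult)
  qed (auto simp: T'_def der[unfolded T'_def])
  define C where "C = 2 * \<beta> * real n + a + 1"
  let ?H = "\<lambda>x::nat \<Rightarrow> real. (\<alpha> * t / 2) * (\<Sum>i\<in>{1..n}. x i ^ (m + 1)) - (t\<^sup>2 / 2) * (\<Sum>i\<in>{1..n}. x i ^ (2 * m + 1))
      - (t * C) * (\<Sum>i\<in>{1..n}. x i ^ m)"
  \<comment> \<open>The bound \<open>?H\<close> keeps the gain to second order in \<open>t\<close> and bounds all losses through \<open>C\<close>.\<close>
  have lower: "?H x \<le> G x" if x: "\<forall>i\<in>{1..n}. 0 \<le> x i" for x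
  proof -
    have "?H x = (\<Sum>i\<in>{1..n}. (\<alpha> * t / 2) * x i ^ (m + 1) - (t\<^sup>2 / 2) * x i ^ (2 * m + 1) - (t * C) * x i ^ m)"
      by (simp add: sum_subtractf sum_distrib_left)
    also have "\<dots> \<le> G x"
      unfolding G_def
    proof (rule sum_mono)
      fix i assume "i \<in> {1..n}"
      then have xi: "0 \<le> x i" using x by simp
      have "T (x i) \<le> x i * (1 - \<alpha> * z (x i) + (z (x i))\<^sup>2)"
        unfolding T_def using \<alpha> xi z_nonneg by (intro mult_left_mono one_plus_powr_neg_le) auto
      then have 1: "\<alpha> * t * x i ^ (m + 1) - t\<^sup>2 * x i ^ (2 * m + 1) \<le> x i - T (x i)"
        by (simp add: z_def algebra_simps power_mult_distrib power_mult[symmetric] power_add)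
      have "\<alpha> * (q + 1) \<le> 1 * a" using \<alpha> q by (intro mult_mono) auto
      then have "\<beta> * (real n - 1) * 2 + (\<alpha> * (q + 1) + 1) \<le> C"
        using beta_pos by (simp add: C_def algebra_simps)
      then have 2: "(\<beta> * (real n - 1) * 2 + (\<alpha> * (q + 1) + 1)) * z (x i) \<le> C * z (x i)"
        using z_nonneg[OF xi] by (rule mult_right_mono)
      show "(\<alpha> * t / 2) * x i ^ (m + 1) - (t\<^sup>2 / 2) * x i ^ (2 * m + 1) - (t * C) * x i ^ m
          \<le> (x i - T (x i)) / 2 - \<beta> * (real n - 1) * (2 * z (x i)) - c (x i)"
        using 1 2 by (simp add: c_def z_def algebra_simps diff_divide_distrib)
    qed
    finally show ?thesis .
  qed
  have upper: "G x \<le> (\<Sum>i\<in>{1..n}. x i ^ 1)" if x: "\<forall>i\<in>{1..n}. 0 \<le> x i" for x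
    unfolding G_def
  proof (rule sum_mono)
    fix i assume "i \<in> {1..n}"
    then have xi: "0 \<le> x i" using x by simp
    have halve: "(u - v) / 2 - w - w' \<le> u" if "0 \<le> u" "0 \<le> v" "0 \<le> w" "0 \<le> w'" for u v w w' :: real
      using that by (simp add: field_simps)
    have "0 \<le> T (x i)" "0 \<le> \<beta> * (real n - 1) * (2 * z (x i))" "0 \<le> c (x i)"
      using xi z_nonneg[OF xi] beta_pos n_pos \<alpha> q by (auto simp: T_def c_def)
    then show "(x i - T (x i)) / 2 - \<beta> * (real n - 1) * (2 * z (x i)) - c (x i) \<le> x i ^ 1"
      unfolding power_one_right using xi by (intro halve)
  qed
  have intH: "integrable Q ?H"
    by (intro Bochner_Integration.integrable_diff integrable_mult_right integrable_power_sum)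
  have [measurable]: "G \<in> borel_measurable (lebesgue_n n)"
    unfolding G_def by (intro borel_measurable_sum) (use measurable_coordinate in measurable)
  have intG: "integrable Q G"
  proof (rule Bochner_Integration.integrable_bound)
    show "integrable Q (\<lambda>x. \<bar>?H x\<bar> + \<bar>\<Sum>i\<in>{1..n}. x i ^ 1\<bar>)"
      by (intro Bochner_Integration.integrable_add integrable_abs intH integrable_power_sum)
    show "AE x in Q. norm (G x) \<le> norm (\<bar>?H x\<bar> + \<bar>\<Sum>i\<in>{1..n}. x i ^ 1\<bar>)"
      using AE_Q_nonneg
    proof eventually_elim
      case (elim x)
      show ?case using lower[OF elim] upper[OF elim] by simp
    qed
  qed measurable
  have "expectation ?H \<le> expectation G"
    using AE_Q_nonneg lower by (intro integral_mono_AE intH intG) (auto elim!: eventually_mono)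
  also have "\<dots> \<le> 0" by (rule expectation_le_0_if_exp_le_1[OF intG]) fact
  finally have "(\<alpha> * t / 2) * moment (m + 1) - (t\<^sup>2 / 2) * moment (2 * m + 1) - (t * C) * moment m \<le> 0"
    unfolding moment_def by (simp add: integrable_power_sum)
  then have "(t / 2) * (\<alpha> * moment (m + 1)) \<le> (t / 2) * (2 * C * moment m + t * moment (2 * m + 1))"
    by (simp add: algebra_simps power2_eq_square)
  then have "\<alpha> * moment (m + 1) \<le> 2 * C * moment m + t * moment (2 * m + 1)"
    using t by simp
  then have "real m * (\<alpha> * moment (m + 1)) \<le> real m * (2 * C * moment m + t * moment (2 * m + 1))"
    by (intro mult_left_mono) auto
  moreover have "real m * (\<alpha> * moment (m + 1)) = moment (m + 1)"
    using \<alpha>(3) by (simp add: mult.assoc[symmetric] mult.commute)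
  ultimately have "moment (m + 1) \<le> real m * (2 * C * moment m + t * moment (2 * m + 1))"
    by (simp only:)
  then show ?thesis
    unfolding Suc_eq_plus1 by (simp add: C_def algebra_simps)
qed

text \<open>The limit \<open>t \<rightarrow> 0\<close> removes the moment of order \<open>2 m + 1\<close>, which is finite but not yet bounded.\<close>

lemma moment_Suc:
  assumes "1 \<le> m"
  shows "moment (Suc m) \<le> 2 * real m * (2 * \<beta> * real n + a + 1) * moment m"
proof -
  let ?B = "2 * real m * (2 * \<beta> * real n + a + 1) * moment m"
  have "((\<lambda>t. ?B + real m * t * moment (2 * m + 1)) \<longlongrightarrow> ?B + real m * 0 * moment (2 * m + 1)) (at_right 0)"
    by (intro tendsto_intros)
  then have "((\<lambda>t. ?B + real m * t * moment (2 * m + 1)) \<longlongrightarrow> ?B) (at_right 0)" by simp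
  moreover have "eventually (\<lambda>t. moment (Suc m) \<le> ?B + real m * t * moment (2 * m + 1)) (at_right 0)"
    using moment_contraction[OF assms] by (intro eventually_at_rightI[of 0 1]) auto
  ultimately show ?thesis
    by (rule tendsto_lowerbound) simp
qed

lemma moment_bound: "moment m \<le> moment_constant \<beta> m * real n * (real n + a + 1) ^ m"
proof (induction m)
  case 0
  then show ?case by (simp add: moment_0)
next
  case (Suc m)
  let ?N = "real n + a + 1"
  have N: "0 \<le> ?N" using a_pos by simp
  have "moment (Suc m) \<le> (2 * real m * (2 * \<beta> + 1) + 4) * ?N * moment m"
  proof (cases "m = 0")
    case True
    have "moment 1 \<le> 4 * a * real n" by (rule moment_1)
    also have "\<dots> \<le> 4 * ?N * real n" by (intro mult_right_mono) auto
    finally show ?thesis using True by (simp add: moment_0 One_nat_def)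
  next
    case False
    then have "moment (Suc m) \<le> 2 * real m * (2 * \<beta> * real n + a + 1) * moment m"
      by (intro moment_Suc) simp
    also have "2 * \<beta> * real n + a + 1 \<le> (2 * \<beta> + 1) * ?N"
      using a_pos beta_pos by (simp add: algebra_simps add_nonneg_nonneg)
    then have "2 * real m * (2 * \<beta> * real n + a + 1) * moment m \<le> 2 * real m * ((2 * \<beta> + 1) * ?N) * moment m"
      by (intro mult_right_mono mult_left_mono moment_nonneg) auto
    also have "\<dots> \<le> (2 * real m * (2 * \<beta> + 1) + 4) * ?N * moment m"
      using N by (intro mult_right_mono moment_nonneg) (simp add: algebra_simps)
    finally show ?thesis .
  qed
  also have "\<dots> \<le> (2 * real m * (2 * \<beta> + 1) + 4) * ?N * (moment_constant \<beta> m * real n * ?N ^ m)"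
    using N beta_pos by (intro mult_left_mono Suc.IH) auto
  finally show ?case by (simp add: mult_ac)
qed

end

section \<open>The Jacobi ensemble as a tilted Laguerre ensemble\<close>

text \<open>The contribution of one coordinate to the ratio of the Jacobi density in the variable \<open>v\<close> and the
  Laguerre density, up to a constant.  It vanishes off \<open>[0, 1]\<close>, since \<open>v\<close> outside this interval
  corresponds to \<open>\<lambda>\<close> outside \<open>[0, 1]\<close>.\<close>

definition tilt_factor :: "real \<Rightarrow> real \<Rightarrow> real \<Rightarrow> real" where
  "tilt_factor A B v =
     (let r = sqrt (A / B) in
      if 0 \<le> v \<and> v \<le> 1 then (1 - v) powr A * (1 + r * v) powr (- B) * exp ((A + B * r) * v) else 0)"

text \<open>The logarithm of the tilt is \<open>A (ln (1 - v) + v) + B (r v - ln (1 + r v))\<close>.  As \<open>B r\<^sup>2 = A\<close>, the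
  quadratic Taylor terms \<open>- A v\<^sup>2 / 2\<close> and \<open>B (r v)\<^sup>2 / 2\<close> cancel.  They also bound the two summands from
  above, which gives the upper bound \<open>1\<close>; the cubic remainder gives the lower bound.  For \<open>v > 1/2\<close> the
  lower bound is trivial since \<open>2 A v\<^sup>3 \<ge> 8 v\<^sup>3 \<ge> 1\<close>.\<close>

lemma tilt_factor_bounds:
  assumes A: "4 \<le> A" and AB: "A \<le> B"
  shows "0 \<le> tilt_factor A B v" "tilt_factor A B v \<le> 1"
    and "0 \<le> v \<Longrightarrow> 1 - tilt_factor A B v \<le> 2 * A * v ^ 3"
proof -
  define r where "r = sqrt (A / B)"
  have r: "0 < r" "r \<le> 1" using A AB by (auto simp: r_def)
  have r2: "B * r\<^sup>2 = A" using A AB by (simp add: r_def)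
  show nonneg: "0 \<le> tilt_factor A B v" by (auto simp: tilt_factor_def Let_def)
  have expo: "tilt_factor A B v = exp (A * (ln (1 - v) + v) + B * (r * v - ln (1 + r * v)))" if v: "0 \<le> v" "v < 1"
  proof -
    have "0 < 1 + r * v" using r v by (simp add: add_pos_nonneg)
    then show ?thesis
      using v by (simp add: tilt_factor_def Let_def r_def[symmetric] powr_def mult_exp_exp algebra_simps)
  qed
  have quad: "B * (r * v)\<^sup>2 = A * v\<^sup>2" for v using r2 by (simp add: power_mult_distrib mult.assoc[symmetric])
  have cube: "B * (r * v) ^ 3 = A * (r * v ^ 3)" for v
    unfolding r2[symmetric] by (simp add: power3_eq_cube power2_eq_square)
  show "tilt_factor A B v \<le> 1"
  proof (cases "0 \<le> v \<and> v < 1")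
    case True
    have "A * (ln (1 - v) + v) \<le> A * (- (v\<^sup>2 / 2))"
      using ln_one_minus_upper[of v] True A by (intro mult_left_mono) auto
    moreover have "B * (r * v - ln (1 + r * v)) \<le> B * ((r * v)\<^sup>2 / 2)"
      using ln_one_plus_lower[of "r * v"] True A AB r by (intro mult_left_mono) auto
    moreover have "B * ((r * v)\<^sup>2 / 2) = A * (v\<^sup>2 / 2)" using quad[of v] by simp
    ultimately show ?thesis using True by (subst expo) auto
  next
    case False
    then show ?thesis using A by (auto simp: tilt_factor_def Let_def)
  qed
  show "1 - tilt_factor A B v \<le> 2 * A * v ^ 3" if v: "0 \<le> v"
  proof (cases "v \<le> 1/2")
    case True
    have "A * (- (v\<^sup>2 / 2) - v ^ 3) \<le> A * (ln (1 - v) + v)"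
      using ln_one_minus_lower[of v] True v A by (intro mult_left_mono) auto
    moreover have "B * ((r * v)\<^sup>2 / 2 - (r * v) ^ 3 / 3) \<le> B * (r * v - ln (1 + r * v))"
      using ln_one_plus_upper[of "r * v"] v A AB r by (intro mult_left_mono) auto
    moreover have "B * ((r * v)\<^sup>2 / 2 - (r * v) ^ 3 / 3) = A * (v\<^sup>2 / 2) - A * (r * v ^ 3) / 3"
      by (simp add: right_diff_distrib quad cube)
    moreover have "A * (r * v ^ 3) \<le> A * (1 * v ^ 3)"
      using r v A by (intro mult_left_mono mult_right_mono) auto
    moreover have "0 \<le> A * v ^ 3" using v A by simp
    ultimately have "- (2 * A * v ^ 3) \<le> A * (ln (1 - v) + v) + B * (r * v - ln (1 + r * v))"
      by (simp add: algebra_simps)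
    also have "\<dots> \<le> tilt_factor A B v - 1"
      using True v expo exp_ge_add_one_self[of "A * (ln (1 - v) + v) + B * (r * v - ln (1 + r * v))"]
      by linarith
    finally show ?thesis by simp
  next
    case False
    then have "(1/2) ^ 3 \<le> v ^ 3" by (intro power_mono) auto
    then have "1 \<le> 8 * v ^ 3" by (simp add: power3_eq_cube)
    also have "\<dots> \<le> 2 * A * v ^ 3" using A v by (intro mult_right_mono) auto
    finally show ?thesis using nonneg by simp
  qed
qed

locale jacobi_laguerre = laguerre_prob \<beta> a n for \<beta> a n +
  fixes a2 :: real
  assumes A_ge: "4 \<le> a2 - ens_p \<beta> n"
begin

text \<open>With \<open>v = \<theta> / \<kappa>\<close> the exponent \<open>(A + B r) v\<close> of \<open>tilt_factor\<close> is \<open>\<theta> / 2\<close>, which cancels the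
  exponential factor of the Laguerre weight.\<close>

definition "A = a2 - ens_p \<beta> n"
definition "B = a + a2"
definition "r = sqrt (A / B)"
definition "\<kappa> = 2 * (A + B * r)"

text \<open>A Moebius map, increasing from \<open>[0, \<kappa>]\<close> onto \<open>[0, 1]\<close>.\<close>

definition jacobi_of_laguerre :: "real \<Rightarrow> real" where
  "jacobi_of_laguerre \<theta> = (1 + r) * (\<theta> / \<kappa>) / (1 + r * (\<theta> / \<kappa>))"

definition tilt :: "(nat \<Rightarrow> real) \<Rightarrow> real" where
  "tilt \<theta> = (\<Prod>i\<in>{1..n}. tilt_factor A B (\<theta> i / \<kappa>))"

lemma ens_p_ge_1: "1 \<le> ens_p \<beta> n"
  using beta_pos n_pos by (simp add: ens_p_def)

lemma A_le_B: "4 \<le> A" "A \<le> B"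
  using ens_p_ge_1 A_ge a_pos by (auto simp: A_def B_def)

lemma r_bounds: "0 < r" "r \<le> 1"
  using A_le_B by (auto simp: r_def)

lemma kappa_ge: "2 * A \<le> \<kappa>" and kappa_pos: "0 < \<kappa>"
  using A_le_B r_bounds by (auto simp: \<kappa>_def intro!: add_pos_pos)

lemma measurable_tilt [measurable]: "tilt \<in> borel_measurable (lebesgue_n n)"
  unfolding tilt_def
proof (intro borel_measurable_prod)
  fix i assume "i \<in> {1..n}"
  note [measurable] = measurable_coordinate[OF this]
  show "(\<lambda>x. tilt_factor A B (x i / \<kappa>)) \<in> borel_measurable (lebesgue_n n)"
    unfolding tilt_factor_def Let_def by measurable
qed

lemma tilt_bounds: "0 \<le> tilt x" "tilt x \<le> 1"
  unfolding tilt_def using tilt_factor_bounds[OF A_le_B]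
  by (auto intro!: prod_nonneg prod_le_1)

text \<open>A product of numbers in \<open>[0, 1]\<close> differs from \<open>1\<close> by at most the sum of the single differences.\<close>

lemma one_minus_tilt_le:
  assumes "\<forall>i\<in>{1..n}. 0 \<le> x i"
  shows "1 - tilt x \<le> (\<Sum>i\<in>{1..n}. x i ^ 3) / (4 * A\<^sup>2)"
proof -
  have gen: "1 - (\<Prod>i\<in>I. f i) \<le> (\<Sum>i\<in>I. 1 - f i)"
    if "finite I" "\<And>i. 0 \<le> f i" "\<And>i. f i \<le> 1" for I :: "nat set" and f :: "nat \<Rightarrow> real"
    using that(1)
  proof (induction I rule: finite_induct)
    case (insert i I)
    have "(\<Prod>i\<in>I. f i) - f i * (\<Prod>i\<in>I. f i) = (1 - f i) * (\<Prod>i\<in>I. f i)" by (simp add: algebra_simps)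
    also have "\<dots> \<le> (1 - f i) * 1"
      using that by (intro mult_left_mono prod_le_1) auto
    finally show ?case using insert by simp
  qed simp
  have "1 - tilt x \<le> (\<Sum>i\<in>{1..n}. 1 - tilt_factor A B (x i / \<kappa>))"
    unfolding tilt_def using tilt_factor_bounds[OF A_le_B] by (intro gen) auto
  also have "\<dots> \<le> (\<Sum>i\<in>{1..n}. x i ^ 3 / (4 * A\<^sup>2))"
  proof (rule sum_mono)
    fix i assume "i \<in> {1..n}"
    then have xi: "0 \<le> x i" using assms by simp
    have "1 - tilt_factor A B (x i / \<kappa>) \<le> 2 * A * (x i / \<kappa>) ^ 3"
      using xi kappa_pos by (intro tilt_factor_bounds(3)[OF A_le_B]) auto
    also have "\<dots> \<le> 2 * A * (x i / (2 * A)) ^ 3"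
      using xi kappa_pos kappa_ge A_le_B by (intro mult_left_mono power_mono divide_left_mono) auto
    also have "\<dots> = x i ^ 3 / (4 * A\<^sup>2)"
      using A_le_B by (simp add: field_simps power3_eq_cube power2_eq_square)
    finally show "1 - tilt_factor A B (x i / \<kappa>) \<le> x i ^ 3 / (4 * A\<^sup>2)" .
  qed
  finally show ?thesis by (simp add: sum_divide_distrib)
qed

lemma expectation_one_minus_tilt: "expectation (\<lambda>x. 1 - tilt x) \<le> moment 3 / (4 * A\<^sup>2)"
proof -
  have "expectation (\<lambda>x. 1 - tilt x) \<le> expectation (\<lambda>x. (\<Sum>i\<in>{1..n}. x i ^ 3) / (4 * A\<^sup>2))"
  proof (rule integral_mono_AE)
    show "integrable Q (\<lambda>x. 1 - tilt x)"
      using tilt_bounds by (intro integrable_const_bound[where B = 1]) auto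
    show "AE x in Q. 1 - tilt x \<le> (\<Sum>i\<in>{1..n}. x i ^ 3) / (4 * A\<^sup>2)"
      using AE_Q_nonneg by eventually_elim (rule one_minus_tilt_le)
  qed (intro integrable_divide integrable_power_sum)
  then show ?thesis by (simp add: moment_def)
qed

text \<open>The factors in \<open>jacobi_density_transform\<close> that do not depend on the point.\<close>

definition density_constant :: real where
  "density_constant = (let q = (1 + r) / \<kappa> in
     jacobi_const \<beta> a a2 n *
       ((sqrt q powr \<beta>) ^ (n - 1) * q powr (a - ens_p \<beta> n) * q) ^ n)"

text \<open>With \<open>h = 1 + r v\<close>, the powers of \<open>h\<close> come from the Vandermonde factor, from \<open>\<lambda>\<close>, from
  \<open>1 - \<lambda> = (1 - v) / h\<close> and from the Jacobian.  Their exponents add up to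
  \<open>- (\<beta> (n - 1) + (a - p) + (a2 - p) + 2) = - (a + a2)\<close>, since \<open>2 p = 2 + \<beta> (n - 1)\<close>; this is the exponent
  of \<open>tilt_factor\<close>.\<close>

lemma jacobi_density_transform:
  assumes x: "\<forall>i\<in>{1..n}. x i \<in> {0..\<kappa>}"
  shows "jacobi_density \<beta> a a2 n (\<lambda>i\<in>{1..n}. jacobi_of_laguerre (x i)) *
      (\<Prod>i\<in>{1..n}. (1 + r) / \<kappa> / (1 + r * (x i / \<kappa>))\<^sup>2) =
    density_constant * (laguerre_weight \<beta> a n x * tilt x)"
proof -
  define q where "q = (1 + r) / \<kappa>"
  define p where "p = ens_p \<beta> n"
  define h where "h i = 1 + r * (x i / \<kappa>)" for i
  define y where "y = (\<lambda>i\<in>{1..n}. jacobi_of_laguerre (x i))"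
  have q: "0 < q" using r_bounds kappa_pos by (simp add: q_def)
  have h: "1 \<le> h i" if "i \<in> {1..n}" for i
    using that x r_bounds kappa_pos by (auto simp: h_def)
  have y: "y i = q * x i / h i" "1 - y i = (1 - x i / \<kappa>) / h i" if "i \<in> {1..n}" for i
  proof -
    show "y i = q * x i / h i" using that by (simp add: y_def jacobi_of_laguerre_def q_def h_def)
    have "y i = (1 + r) * (x i / \<kappa>) / h i" using that by (simp add: y_def jacobi_of_laguerre_def h_def)
    then have "1 - y i = (h i - (1 + r) * (x i / \<kappa>)) / h i"
      using h[OF that] by (simp add: diff_divide_distrib)
    also have "h i - (1 + r) * (x i / \<kappa>) = 1 - x i / \<kappa>" by (simp add: h_def algebra_simps add_divide_distrib)
    finally show "1 - y i = (1 - x i / \<kappa>) / h i" .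
  qed
  have v: "0 \<le> x i / \<kappa>" "x i / \<kappa> \<le> 1" if "i \<in> {1..n}" for i
    using that x kappa_pos by auto
  have y01: "\<forall>i\<in>{1..n}. 0 \<le> y i \<and> y i \<le> 1"
  proof
    fix i assume i: "i \<in> {1..n}"
    have "0 \<le> y i" using i x q h[OF i] by (subst y) auto
    moreover have "0 \<le> 1 - y i" using v[OF i] h[OF i] by (subst y(2)[OF i]) auto
    ultimately show "0 \<le> y i \<and> y i \<le> 1" by simp
  qed
  have V: "vandermonde_abs \<beta> n y = vandermonde_abs \<beta> n x * (\<Prod>i\<in>{1..n}. ((sqrt q / h i) powr \<beta>) ^ (n - 1))"
  proof (rule vandermonde_abs_scaled)
    fix i j assume ij: "i \<in> {1..n}" "j \<in> {1..n}" "i < j"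
    have "x i * h j - x j * h i = x i - x j" by (simp add: h_def algebra_simps)
    moreover have "y i - y j = (q * x i * h j - q * x j * h i) / (h i * h j)"
      unfolding y(1)[OF ij(1)] y(1)[OF ij(2)] using h[OF ij(1)] h[OF ij(2)] by (intro diff_frac_eq) auto
    moreover have "q * x i * h j - q * x j * h i = q * (x i * h j - x j * h i)" by (simp add: algebra_simps)
    ultimately have "y i - y j = (x i - x j) * (q / (h i * h j))" by simp
    also have "q / (h i * h j) = sqrt q / h i * (sqrt q / h j)" using q by simp
    finally show "\<bar>y i - y j\<bar> = \<bar>x i - x j\<bar> * (sqrt q / h i * (sqrt q / h j))"
      using q h[OF ij(1)] h[OF ij(2)] by (simp add: abs_mult)
  qed (use q h in \<open>force intro!: divide_nonneg_nonneg\<close>)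
  have particle: "((sqrt q / h i) powr \<beta>) ^ (n - 1) * (y i powr (a - p) * (1 - y i) powr (a2 - p)) * (q / (h i)\<^sup>2) =
      ((sqrt q powr \<beta>) ^ (n - 1) * q powr (a - p) * q) *
      (x i powr (a - p) * exp (- (1/2) * x i) * tilt_factor A B (x i / \<kappa>))" if i: "i \<in> {1..n}" for i
  proof -
    have hi: "0 < h i" using h[OF i] by simp
    have e1: "((sqrt q / h i) powr \<beta>) ^ (n - 1) = (sqrt q powr \<beta>) ^ (n - 1) * h i powr (- (\<beta> * (real n - 1)))"
    proof -
      have "(h i powr \<beta>) ^ (n - 1) = (h i powr \<beta>) powr real (n - 1)"
        using hi by (intro powr_realpow[symmetric]) simp
      also have "\<dots> = h i powr (\<beta> * (real n - 1))"
        using n_pos by (simp add: powr_powr of_nat_diff)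
      finally have "(h i powr \<beta>) ^ (n - 1) = h i powr (\<beta> * (real n - 1))" .
      then show ?thesis using q hi by (simp add: powr_divide power_divide powr_minus_divide)
    qed
    have e2: "y i powr (a - p) = q powr (a - p) * x i powr (a - p) * h i powr (- (a - p))"
      unfolding y(1)[OF i] powr_minus_divide using q hi x i by (simp add: powr_divide powr_mult)
    have e3: "(1 - y i) powr (a2 - p) = (1 - x i / \<kappa>) powr A * h i powr (- A)"
      unfolding y(2)[OF i] A_def p_def[symmetric] powr_minus_divide using hi v[OF i] by (simp add: powr_divide)
    have e4: "q / (h i)\<^sup>2 = q * h i powr (- 2)"
      using hi by (simp add: powr_minus_divide powr_numeral)
    have hh: "h i powr (- (\<beta> * (real n - 1))) * h i powr (- (a - p)) * h i powr (- A) * h i powr (- 2) = h i powr (- B)"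
      unfolding powr_add[symmetric] A_def B_def p_def ens_p_def
      by (rule arg_cong2[where f = "(powr)"]) (auto simp: algebra_simps)
    have half: "(A + B * r) * (x i / \<kappa>) = x i / 2"
      using kappa_pos unfolding \<kappa>_def by (simp add: field_simps)
    have "tilt_factor A B (x i / \<kappa>) =
        (1 - x i / \<kappa>) powr A * h i powr (- B) * exp ((A + B * r) * (x i / \<kappa>))"
      unfolding tilt_factor_def Let_def r_def[symmetric] h_def using v[OF i] by simp
    moreover have "exp (- (1/2) * x i) * exp (x i / 2) = 1" by (simp add: mult_exp_exp)
    ultimately have t: "exp (- (1/2) * x i) * tilt_factor A B (x i / \<kappa>) = (1 - x i / \<kappa>) powr A * h i powr (- B)"
      unfolding half by (simp add: mult.left_commute[of "exp (- (1/2) * x i)"])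
    show ?thesis
      unfolding e1 e2 e3 e4 mult.assoc t hh[symmetric] by (simp only: mult_ac)
  qed
  have "jacobi_density \<beta> a a2 n y * (\<Prod>i\<in>{1..n}. q / (h i)\<^sup>2) =
      jacobi_const \<beta> a a2 n * vandermonde_abs \<beta> n x *
      (\<Prod>i\<in>{1..n}. ((sqrt q / h i) powr \<beta>) ^ (n - 1) * (y i powr (a - p) * (1 - y i) powr (a2 - p)) * (q / (h i)\<^sup>2))"
    using y01 unfolding jacobi_density_def V p_def[symmetric] prod.distrib by (simp add: mult_ac)
  also have "\<dots> = jacobi_const \<beta> a a2 n * vandermonde_abs \<beta> n x *
      (\<Prod>i\<in>{1..n}. ((sqrt q powr \<beta>) ^ (n - 1) * q powr (a - p) * q) *
      (x i powr (a - p) * exp (- (1/2) * x i) * tilt_factor A B (x i / \<kappa>)))"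
    by (rule arg_cong[where f = "(*) (jacobi_const \<beta> a a2 n * vandermonde_abs \<beta> n x)"])
       (rule prod.cong[OF refl particle])
  also have "\<dots> = density_constant * (laguerre_weight \<beta> a n x * tilt x)"
  proof -
    have "exp (- (1/2) * (\<Sum>i\<in>{1..n}. x i)) = (\<Prod>i\<in>{1..n}. exp (- (1/2) * x i))"
      by (simp add: exp_sum[symmetric] sum_distrib_left)
    then show ?thesis
      using x unfolding density_constant_def Let_def q_def[symmetric] laguerre_weight_def tilt_def p_def[symmetric]
      by (simp add: prod.distrib)
  qed
  finally show ?thesis unfolding y_def q_def h_def .
qed

lemma nn_integral_jacobi_eq_tilted_laguerre:
  assumes [measurable]: "F \<in> borel_measurable (lebesgue_n n)"
  shows "(\<integral>\<^sup>+ x. ennreal (jacobi_density \<beta> a a2 n x) * F x \<partial>lebesgue_n n) =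
    ennreal density_constant * partition_function *
      (\<integral>\<^sup>+ x. F (\<lambda>i\<in>{1..n}. jacobi_of_laguerre (x i)) * ennreal (tilt x) \<partial>Q)"
proof -
  let ?g' = "\<lambda>x. (1 + r) / \<kappa> / (1 + r * (x / \<kappa>))\<^sup>2"
  have [measurable]: "jacobi_density \<beta> a a2 n \<in> borel_measurable (lebesgue_n n)"
    unfolding jacobi_density_def by measurable
  have [measurable]: "jacobi_of_laguerre \<in> borel_measurable borel"
    unfolding jacobi_of_laguerre_def by measurable
  have h: "1 + r * (x / \<kappa>) \<noteq> 0" if "x \<in> {0..\<kappa>}" for x
    using that r_bounds kappa_pos by (auto simp: add_nonneg_eq_0_iff)
  have ends: "jacobi_of_laguerre 0 = 0" "jacobi_of_laguerre \<kappa> = 1"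
    using kappa_pos r_bounds by (auto simp: jacobi_of_laguerre_def)
  have "(\<integral>\<^sup>+ x. ennreal (jacobi_density \<beta> a a2 n x) * F x \<partial>lebesgue_n n) =
      (\<integral>\<^sup>+ x. ennreal (jacobi_density \<beta> a a2 n x) * F x *
        (\<Prod>i\<in>{1..n}. indicator {jacobi_of_laguerre 0..jacobi_of_laguerre \<kappa>} (x i)) \<partial>lebesgue_n n)"
    unfolding ends by (intro nn_integral_cong) (auto simp: jacobi_density_def prod_indicator)
  also have "\<dots> = (\<integral>\<^sup>+ x. (ennreal (jacobi_density \<beta> a a2 n (\<lambda>i\<in>{1..n}. jacobi_of_laguerre (x i))) *
         F (\<lambda>i\<in>{1..n}. jacobi_of_laguerre (x i))) *
        (\<Prod>i\<in>{1..n}. ennreal (?g' (x i)) * indicator {0..\<kappa>} (x i)) \<partial>lebesgue_n n)"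
  proof (rule nn_integral_PiM_substitution[where f = "\<lambda>x. ennreal (jacobi_density \<beta> a a2 n x) * F x"
            and g = jacobi_of_laguerre and g' = ?g' and b = \<kappa> and I = "{1..n}"])
    fix x assume x: "x \<in> {0..\<kappa>}"
    have "(jacobi_of_laguerre has_real_derivative
        (((1 + r) / \<kappa>) * (1 + r * (x / \<kappa>)) - (1 + r) * (x / \<kappa>) * (r / \<kappa>)) / ((1 + r * (x / \<kappa>)) * (1 + r * (x / \<kappa>)))) (at x)"
      unfolding jacobi_of_laguerre_def
      by (rule DERIV_divide) (use h[OF x] kappa_pos in \<open>auto intro!: derivative_eq_intros\<close>)
    also have "((1 + r) / \<kappa>) * (1 + r * (x / \<kappa>)) - (1 + r) * (x / \<kappa>) * (r / \<kappa>) = (1 + r) / \<kappa>"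
      by (simp add: algebra_simps)
    finally show "(jacobi_of_laguerre has_real_derivative ?g' x) (at x)"
      by (simp add: power2_eq_square)
    show "0 \<le> ?g' x" using r_bounds kappa_pos by simp
  next
    show "continuous_on {0..\<kappa>} ?g'"
      using h kappa_pos by (intro continuous_intros) auto
  qed (use kappa_pos in measurable)
  also have "\<dots> = (\<integral>\<^sup>+ x. ennreal density_constant * (ennreal (laguerre_weight \<beta> a n x) *
      (F (\<lambda>i\<in>{1..n}. jacobi_of_laguerre (x i)) * ennreal (tilt x))) \<partial>lebesgue_n n)"
  proof (rule nn_integral_cong)
    fix x :: "nat \<Rightarrow> real"
    let ?y = "\<lambda>i\<in>{1..n}. jacobi_of_laguerre (x i)"
    show "ennreal (jacobi_density \<beta> a a2 n ?y) * F ?y * (\<Prod>i\<in>{1..n}. ennreal (?g' (x i)) * indicator {0..\<kappa>} (x i)) =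
        ennreal density_constant * (ennreal (laguerre_weight \<beta> a n x) * (F ?y * ennreal (tilt x)))"
    proof (cases "\<forall>i\<in>{1..n}. x i \<in> {0..\<kappa>}")
      case True
      have g'_nonneg: "0 \<le> ?g' t" for t using r_bounds kappa_pos by simp
      have "ennreal (jacobi_density \<beta> a a2 n ?y) * (\<Prod>i\<in>{1..n}. ennreal (?g' (x i))) =
          ennreal (jacobi_density \<beta> a a2 n ?y * (\<Prod>i\<in>{1..n}. ?g' (x i)))"
        by (subst prod_ennreal[OF g'_nonneg]) (rule ennreal_mult''[symmetric], intro prod_nonneg g'_nonneg ballI)
      also have "\<dots> = ennreal (density_constant * (laguerre_weight \<beta> a n x * tilt x))"
        by (simp only: jacobi_density_transform[OF True])
      also have "\<dots> = ennreal density_constant * (ennreal (laguerre_weight \<beta> a n x) * ennreal (tilt x))"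
        by (simp add: ennreal_mult'' ennreal_mult laguerre_weight_nonneg tilt_bounds)
      finally have "F ?y * (ennreal (jacobi_density \<beta> a a2 n ?y) * (\<Prod>i\<in>{1..n}. ennreal (?g' (x i)))) =
          F ?y * (ennreal density_constant * (ennreal (laguerre_weight \<beta> a n x) * ennreal (tilt x)))"
        by simp
      then show ?thesis
        unfolding prod.distrib prod_indicator[OF finite_atLeastAtMost] using True by (simp add: mult_ac)
    next
      case False
      then obtain i where "i \<in> {1..n}" "x i \<notin> {0..\<kappa>}" by blast
      then have "tilt x = 0"
        unfolding tilt_def using kappa_pos
        by (intro prod_zero bexI[of _ i]) (auto simp: tilt_factor_def Let_def divide_simps)
      then show ?thesis
        unfolding prod.distrib prod_indicator[OF finite_atLeastAtMost] using False by auto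
    qed
  qed
  also have "\<dots> = ennreal density_constant * (\<integral>\<^sup>+ x. ennreal (laguerre_weight \<beta> a n x) *
      (F (\<lambda>i\<in>{1..n}. jacobi_of_laguerre (x i)) * ennreal (tilt x)) \<partial>lebesgue_n n)"
    by (rule nn_integral_cmult) measurable
  also have "\<dots> = ennreal density_constant * (partition_function *
      (\<integral>\<^sup>+ x. F (\<lambda>i\<in>{1..n}. jacobi_of_laguerre (x i)) * ennreal (tilt x) \<partial>Q))"
    using partition_function_finite
    by (subst nn_integral_Q, measurable)
       (simp add: ennreal_times_divide mult_divide_eq_ennreal mult.commute[of partition_function])
  finally show ?thesis by (simp add: mult.assoc)
qed

end

section \<open>Perturbation of weak limits\<close>

lemma std_normal_vector_prob: "prob_space (std_normal_vector :: (real ^ 'k::finite) measure)"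
proof
  let ?f = "\<lambda>b y. ennreal (std_normal_density y)"
  have "emeasure (std_normal_vector :: (real ^ 'k) measure) (space std_normal_vector) =
      integral\<^sup>N lborel (\<lambda>z :: real ^ 'k. ennreal (\<Prod>l\<in>UNIV. std_normal_density (z $ l)))"
    unfolding std_normal_vector_def
    by (subst emeasure_density) (auto intro!: nn_integral_cong)
  also have "\<dots> = integral\<^sup>N lborel (\<lambda>z :: real ^ 'k. (\<Prod>b\<in>Basis. ?f b (z \<bullet> b)))"
  proof (intro nn_integral_cong)
    fix z :: "real ^ 'k"
    have "(\<Prod>b\<in>(Basis :: (real ^ 'k) set). ?f b (z \<bullet> b)) =
        (\<Prod>b\<in>(\<lambda>l :: 'k. axis l (1::real)) ` UNIV. ?f b (z \<bullet> b))"
      by (intro prod.cong) (auto simp: Basis_vec_def)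
    also have "\<dots> = (\<Prod>l\<in>UNIV. ennreal (std_normal_density (z $ l)))"
      by (subst prod.reindex) (auto simp: inj_on_def axis_eq_axis inner_axis)
    finally show "ennreal (\<Prod>l\<in>UNIV. std_normal_density (z $ l)) = (\<Prod>b\<in>Basis. ?f b (z \<bullet> b))"
      by (simp add: prod_ennreal)
  qed
  also have "\<dots> = (\<Prod>b\<in>(Basis :: (real ^ 'k) set). \<integral>\<^sup>+ y. ?f b y \<partial>lborel)"
    by (rule nn_integral_lborel_prod) auto
  also have "(\<integral>\<^sup>+ y. ennreal (std_normal_density y) \<partial>lborel) = 1"
    using prob_space.emeasure_space_1[OF prob_space_normal_density[of 1 0]]
    by (simp add: emeasure_density)
  finally show "emeasure (std_normal_vector :: (real ^ 'k) measure) (space std_normal_vector) = 1" by simp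
qed

lemma multivariate_normal_prob:
  fixes \<mu> :: "real ^ 'k::finite"
  assumes "multivariate_normal \<mu> \<Sigma> N"
  shows "prob_space N" "sets N = sets borel"
proof -
  obtain A :: "real ^ 'k ^ 'k" where N: "N = distr std_normal_vector borel (\<lambda>z. \<mu> + A *v z)"
    using assms unfolding multivariate_normal_def by blast
  have "(\<lambda>z. \<mu> + A *v z) \<in> borel_measurable borel"
    by (intro borel_measurable_continuous_onI continuous_intros)
  then have "(\<lambda>z. \<mu> + A *v z) \<in> measurable std_normal_vector borel"
    by (simp add: std_normal_vector_def)
  then show "prob_space N"
    unfolding N by (intro prob_space.prob_space_distr std_normal_vector_prob)
  show "sets N = sets borel" by (simp add: N)
qed

text \<open>A continuous substitute for the indicator of the complement of a ball, so that weak convergence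
  applies to it.\<close>

definition norm_cutoff :: "real \<Rightarrow> 'a::real_normed_vector \<Rightarrow> real" where
  "norm_cutoff R x = max 0 (min 1 (norm x - R))"

lemma norm_cutoff_bounds: "0 \<le> norm_cutoff R x" "norm_cutoff R x \<le> 1"
    "\<bar>norm_cutoff R x\<bar> \<le> 1"
  by (auto simp: norm_cutoff_def)

lemma continuous_on_norm_cutoff: "continuous_on A (norm_cutoff R)"
  unfolding norm_cutoff_def by (intro continuous_intros)

lemma norm_cutoff_integral_tendsto_0:
  fixes N :: "'a::real_normed_vector measure"
  assumes "prob_space N" "sets N = sets borel"
  shows "(\<lambda>k. \<integral>x. norm_cutoff (real k) x \<partial>N) \<longlonglongrightarrow> 0"
proof -
  interpret prob_space N by fact
  note [measurable_cong] = assms(2)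
  have [measurable]: "norm_cutoff R \<in> borel_measurable borel" for R
    by (intro borel_measurable_continuous_onI continuous_on_norm_cutoff)
  have "(\<lambda>k. \<integral>x. norm_cutoff (real k) x \<partial>N) \<longlonglongrightarrow> (\<integral>x. 0 \<partial>N)"
  proof (rule integral_dominated_convergence[where w = "\<lambda>_. 1"])
    show "AE x in N. (\<lambda>k. norm_cutoff (real k) x) \<longlonglongrightarrow> 0"
    proof (rule AE_I2)
      fix x :: 'a
      obtain K where "norm x \<le> real K" using real_arch_simple by blast
      then have "norm_cutoff (real k) x = 0" if "K \<le> k" for k
        using that by (auto simp: norm_cutoff_def)
      then show "(\<lambda>k. norm_cutoff (real k) x) \<longlonglongrightarrow> 0"
        by (intro tendsto_eventually eventually_sequentiallyI[of K])
    qed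
    show "AE x in N. norm (norm_cutoff (real k) x) \<le> 1" for k
      using norm_cutoff_bounds(3)[of "real k"] by auto
  qed auto
  then show ?thesis by simp
qed

text \<open>One of three cases applies: \<open>x\<close> and \<open>y\<close> are far apart, or \<open>y\<close> is large, or both lie in a compact ball
  on which \<open>f\<close> is uniformly continuous.  Stated as a pointwise inequality, the case distinction can be
  integrated at once.\<close>

lemma bounded_continuous_increment:
  fixes f :: "'a::euclidean_space \<Rightarrow> real"
  assumes f: "continuous_on UNIV f" and C: "\<And>x. \<bar>f x\<bar> \<le> C" and "0 < \<epsilon>"
  shows "\<exists>\<delta>>0. \<forall>x y. \<bar>f x - f y\<bar> \<le> \<epsilon> + 2 * C * norm_cutoff R y + (2 * C / \<delta>) * norm (x - y)"
proof -
  have "uniformly_continuous_on (cball 0 (R + 2)) f"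
    by (intro compact_uniformly_continuous continuous_on_subset[OF f]) auto
  then obtain d where d: "0 < d"
    "\<And>x y. x \<in> cball 0 (R + 2) \<Longrightarrow> y \<in> cball 0 (R + 2) \<Longrightarrow> dist y x < d \<Longrightarrow> dist (f y) (f x) < \<epsilon>"
    unfolding uniformly_continuous_on_def using \<open>0 < \<epsilon>\<close> by metis
  define \<delta> where "\<delta> = min d 1"
  have \<delta>: "0 < \<delta>" using d by (simp add: \<delta>_def)
  have C_nonneg: "0 \<le> C" using C[of 0] by linarith
  show ?thesis
  proof (intro exI[of _ \<delta>] conjI allI \<delta>)
    fix x y
    have crude: "\<bar>f x - f y\<bar> \<le> 2 * C" using C[of x] C[of y] by linarith
    have terms: "0 \<le> 2 * C * norm_cutoff R y" "0 \<le> (2 * C / \<delta>) * norm (x - y)"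
      using C_nonneg \<delta> norm_cutoff_bounds[of R y] by auto
    consider "\<delta> \<le> norm (x - y)" | "R + 1 \<le> norm y" | "norm (x - y) < \<delta>" "norm y < R + 1"
      by linarith
    then show "\<bar>f x - f y\<bar> \<le> \<epsilon> + 2 * C * norm_cutoff R y + (2 * C / \<delta>) * norm (x - y)"
    proof cases
      case 1
      then have "2 * C \<le> (2 * C / \<delta>) * norm (x - y)"
        using \<delta> C_nonneg mult_left_mono[of \<delta> "norm (x - y)" "2 * C"] by (simp add: field_simps)
      then show ?thesis using crude terms \<open>0 < \<epsilon>\<close> by linarith
    next
      case 2
      then have "norm_cutoff R y = 1" by (simp add: norm_cutoff_def)
      then show ?thesis using crude terms \<open>0 < \<epsilon>\<close> by simp
    next
      case 3
      have "norm x \<le> norm y + norm (x - y)" by (metis norm_triangle_sub)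
      then have "norm x \<le> R + 2" using 3 by (simp add: \<delta>_def)
      then have "dist (f x) (f y) < \<epsilon>"
        using 3 by (intro d(2)) (auto simp: dist_norm \<delta>_def)
      then show ?thesis using terms by (simp add: dist_real_def)
    qed
  qed
qed

text \<open>Slutsky's theorem, with closeness measured in mean.  Integrating \<open>bounded_continuous_increment\<close> leaves
  the mean of the cutoff at \<open>Y n\<close>, which is small by the convergence of \<open>Y n\<close> and the tightness of \<open>N\<close>.\<close>

lemma weakly_converges_distr_perturb:
  fixes Q :: "nat \<Rightarrow> 'b measure" and X Y :: "nat \<Rightarrow> 'b \<Rightarrow> 'a::euclidean_space"
  assumes N: "prob_space N" "sets N = sets borel"
    and Q: "\<And>n. n \<ge> n0 \<Longrightarrow> prob_space (Q n)"
    and X: "\<And>n. n \<ge> n0 \<Longrightarrow> X n \<in> borel_measurable (Q n)"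
    and Y: "\<And>n. n \<ge> n0 \<Longrightarrow> Y n \<in> borel_measurable (Q n)"
    and conv: "weakly_converges (\<lambda>n. distr (Q n) borel (Y n)) N"
    and int: "\<And>n. n \<ge> n0 \<Longrightarrow> integrable (Q n) (\<lambda>x. norm (X n x - Y n x))"
    and close: "(\<lambda>n. \<integral>x. norm (X n x - Y n x) \<partial>Q n) \<longlonglongrightarrow> 0"
  shows "weakly_converges (\<lambda>n. distr (Q n) borel (X n)) N"
  unfolding weakly_converges_def
proof (intro allI impI, elim conjE)
  fix f :: "'a \<Rightarrow> real" assume f: "continuous_on UNIV f" "bounded (range f)"
  have [measurable]: "f \<in> borel_measurable borel" by (rule borel_measurable_continuous_onI[OF f(1)])
  obtain C where C: "\<And>x. \<bar>f x\<bar> \<le> C" using f(2) unfolding bounded_iff by auto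
  have cut_meas [measurable]: "norm_cutoff R \<in> borel_measurable borel" for R :: real
    by (intro borel_measurable_continuous_onI continuous_on_norm_cutoff)
  have C_nonneg: "0 \<le> C" using C[of 0] by linarith
  have limY: "(\<lambda>n. \<integral>x. f x \<partial>distr (Q n) borel (Y n)) \<longlonglongrightarrow> (\<integral>x. f x \<partial>N)"
    using conv f unfolding weakly_converges_def by blast
  have limCut: "(\<lambda>n. \<integral>x. norm_cutoff R x \<partial>distr (Q n) borel (Y n)) \<longlonglongrightarrow> (\<integral>x. norm_cutoff R x \<partial>N)" for R
  proof -
    have "bounded (range (norm_cutoff R :: 'a \<Rightarrow> real))"
      using norm_cutoff_bounds(3)[of R] by (auto simp: bounded_iff intro!: exI[of _ 1])
    then show ?thesis
      using conv continuous_on_norm_cutoff unfolding weakly_converges_def by blast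
  qed
  have "(\<lambda>n. (\<integral>x. f (X n x) \<partial>Q n) - (\<integral>x. f (Y n x) \<partial>Q n)) \<longlonglongrightarrow> 0"
  proof (rule tendstoI)
    fix \<epsilon> :: real assume "0 < \<epsilon>"
    define \<eta> where "\<eta> = \<epsilon> / (4 + 4 * C)"
    have \<eta>: "0 < \<eta>" "\<eta> * (4 + 4 * C) = \<epsilon>" using \<open>0 < \<epsilon>\<close> C_nonneg by (auto simp: \<eta>_def)
    obtain k :: nat where k: "(\<integral>x. norm_cutoff (real k) x \<partial>N) < \<eta>"
      using order_tendstoD(2)[OF norm_cutoff_integral_tendsto_0[OF N] \<eta>(1)]
      unfolding eventually_sequentially by blast
    obtain \<delta> where \<delta>: "0 < \<delta>"
      "\<And>x y. \<bar>f x - f y\<bar> \<le> \<eta> + 2 * C * norm_cutoff (real k) y + (2 * C / \<delta>) * norm (x - y)"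
      using bounded_continuous_increment[OF f(1) C \<eta>(1), where R = "real k"] by blast
    have "(\<lambda>n. (2 * C / \<delta>) * (\<integral>x. norm (X n x - Y n x) \<partial>Q n)) \<longlonglongrightarrow> (2 * C / \<delta>) * 0"
      by (intro tendsto_intros close)
    then have "eventually (\<lambda>n. (2 * C / \<delta>) * (\<integral>x. norm (X n x - Y n x) \<partial>Q n) < \<eta>) sequentially"
      using \<eta>(1) by (intro order_tendstoD(2)) auto
    moreover have "eventually (\<lambda>n. (\<integral>x. norm_cutoff (real k) x \<partial>distr (Q n) borel (Y n)) < \<eta>) sequentially"
      using limCut[of "real k"] k by (rule order_tendstoD(2))
    ultimately show "eventually (\<lambda>n. dist ((\<integral>x. f (X n x) \<partial>Q n) - (\<integral>x. f (Y n x) \<partial>Q n)) 0 < \<epsilon>) sequentially"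
      using eventually_ge_at_top[of n0]
    proof eventually_elim
      case (elim n)
      interpret prob_space "Q n" by (rule Q) fact
      note [measurable] = X[OF elim(3)] Y[OF elim(3)]
      have ifX: "integrable (Q n) (\<lambda>x. f (X n x))" and ifY: "integrable (Q n) (\<lambda>x. f (Y n x))"
        using C by (auto intro!: integrable_const_bound[where B = C])
      have icut: "integrable (Q n) (\<lambda>x. norm_cutoff (real k) (Y n x))"
        by (auto intro!: integrable_const_bound[where B = 1] simp: norm_cutoff_bounds)
      have "\<bar>expectation (\<lambda>x. f (X n x)) - expectation (\<lambda>x. f (Y n x))\<bar> =
          \<bar>expectation (\<lambda>x. f (X n x) - f (Y n x))\<bar>" using ifX ifY by simp
      also have "\<dots> \<le> expectation (\<lambda>x. \<bar>f (X n x) - f (Y n x)\<bar>)" by (rule integral_abs_bound)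
      also have "\<dots> \<le> expectation (\<lambda>x. \<eta> + 2 * C * norm_cutoff (real k) (Y n x) + (2 * C / \<delta>) * norm (X n x - Y n x))"
        using ifX ifY icut int[OF elim(3)] \<delta>(2) by (intro integral_mono) auto
      also have "\<dots> = \<eta> + 2 * C * expectation (\<lambda>x. norm_cutoff (real k) (Y n x)) + (2 * C / \<delta>) * expectation (\<lambda>x. norm (X n x - Y n x))"
        using icut int[OF elim(3)] by (simp add: prob_space)
      also have "\<dots> \<le> \<eta> + 2 * C * \<eta> + \<eta>"
        using elim(1,2) C_nonneg by (intro add_mono mult_left_mono) (auto simp: integral_distr)
      also have "\<dots> < \<epsilon>" using \<eta>(1) C_nonneg
        by (simp add: algebra_simps add_pos_nonneg flip: \<eta>(2))
      finally show ?case by (simp add: dist_real_def)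
    qed
  qed
  moreover have "eventually (\<lambda>n. (\<integral>x. f (X n x) \<partial>Q n) - (\<integral>x. f (Y n x) \<partial>Q n) =
      (\<integral>x. f x \<partial>distr (Q n) borel (X n)) - (\<integral>x. f x \<partial>distr (Q n) borel (Y n))) sequentially"
    using eventually_ge_at_top[of n0] by eventually_elim (use X Y in \<open>simp add: integral_distr\<close>)
  ultimately have "(\<lambda>n. (\<integral>x. f x \<partial>distr (Q n) borel (X n)) - (\<integral>x. f x \<partial>distr (Q n) borel (Y n))) \<longlonglongrightarrow> 0"
    by (rule Lim_transform_eventually)
  from tendsto_add[OF this limY]
  show "(\<lambda>n. \<integral>x. f x \<partial>distr (Q n) borel (X n)) \<longlonglongrightarrow> (\<integral>x. f x \<partial>N)" by simp
qed

text \<open>The constant \<open>K\<close> is determined by the total mass, \<open>K E l = 1\<close>, so it is at least \<open>1\<close> and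
  \<open>E \<bar>K l - 1\<bar> \<le> (K - 1) E l + E (1 - l) = 2 E (1 - l)\<close>.\<close>

lemma tilted_expectation:
  fixes Q :: "'a measure" and P :: "'b measure" and l :: "'a \<Rightarrow> real" and f :: "'b \<Rightarrow> real"
  assumes "prob_space Q" "prob_space P"
    and [measurable]: "\<Phi> \<in> measurable Q P" "l \<in> borel_measurable Q" "f \<in> borel_measurable P"
    and l: "\<And>x. 0 \<le> l x" "\<And>x. l x \<le> 1"
    and tilt: "\<And>F. F \<in> borel_measurable P \<Longrightarrow> (\<integral>\<^sup>+ y. F y \<partial>P) = K * (\<integral>\<^sup>+ x. F (\<Phi> x) * ennreal (l x) \<partial>Q)"
    and C: "\<And>y. \<bar>f y\<bar> \<le> C"
  shows "\<bar>(\<integral>y. f y \<partial>P) - (\<integral>x. f (\<Phi> x) \<partial>Q)\<bar> \<le> 2 * C * (\<integral>x. 1 - l x \<partial>Q)"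
proof -
  interpret Q: prob_space Q by fact
  interpret P: prob_space P by fact
  have il: "integrable Q l" using l by (intro Q.integrable_const_bound[where B = 1]) auto
  define L where "L = Q.expectation l"
  have L: "(\<integral>\<^sup>+ x. ennreal (l x) \<partial>Q) = ennreal L" "L \<le> 1" "0 \<le> L"
    unfolding L_def using il l by (auto simp: nn_integral_eq_integral intro!: Q.integral_le_const)
  have "K * ennreal L = 1"
    using tilt[of "\<lambda>_. 1"] by (simp add: L P.emeasure_space_1)
  then have "0 < L" "K \<noteq> \<infinity>" using L
    by (auto simp: ennreal_top_mult order_less_le split: if_splits)
  then obtain k where k: "K = ennreal k" "0 \<le> k" by (cases K) auto
  have kL: "k * L = 1"
    using \<open>K * ennreal L = 1\<close> k L(3) by (simp add: ennreal_mult[symmetric])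
  have k1: "1 \<le> k" using kL L k by (metis mult_left_mono mult_1_right)
  have P_eq: "P = distr (density Q (\<lambda>x. ennreal (k * l x))) P \<Phi>"
  proof (rule measure_eqI)
    fix A assume "A \<in> sets P"
    then have [measurable]: "A \<in> sets P" .
    have "emeasure P A = (\<integral>\<^sup>+ y. indicator A y \<partial>P)" by simp
    also have "\<dots> = (\<integral>\<^sup>+ x. ennreal (k * l x) * indicator A (\<Phi> x) \<partial>Q)"
      unfolding k by (subst tilt, simp, subst nn_integral_cmult[symmetric])
        (auto simp: k ennreal_mult k l mult_ac intro!: nn_integral_cong)
    also have "\<dots> = (\<integral>\<^sup>+ y. indicator A y \<partial>distr (density Q (\<lambda>x. ennreal (k * l x))) P \<Phi>)"
      by (subst nn_integral_distr, simp, simp, subst nn_integral_density) auto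
    finally show "emeasure P A = emeasure (distr (density Q (\<lambda>x. ennreal (k * l x))) P \<Phi>) A" by simp
  qed simp
  have C_nonneg: "0 \<le> C" using C[of undefined] by linarith
  have iff: "integrable Q (\<lambda>x. f (\<Phi> x))" using C by (intro Q.integrable_const_bound[where B = C]) auto
  have iklf: "integrable Q (\<lambda>x. k * l x * f (\<Phi> x))"
  proof (rule Q.integrable_const_bound[where B = "k * C"])
    have "k * l x * \<bar>f (\<Phi> x)\<bar> \<le> k * C" for x
      using C[of "\<Phi> x"] l[of x] k mult_mono[of "l x" 1 "\<bar>f (\<Phi> x)\<bar>" C] by (auto simp: mult.assoc intro!: mult_left_mono)
    then show "AE x in Q. norm (k * l x * f (\<Phi> x)) \<le> k * C"
      using k l by (simp add: abs_mult)
  qed simp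
  have "(\<integral>y. f y \<partial>P) = (\<integral>x. k * l x * f (\<Phi> x) \<partial>Q)"
    using k l by (subst P_eq, subst integral_distr, simp, simp, subst integral_real_density) auto
  then have "\<bar>(\<integral>y. f y \<partial>P) - (\<integral>x. f (\<Phi> x) \<partial>Q)\<bar> = \<bar>\<integral>x. k * l x * f (\<Phi> x) - f (\<Phi> x) \<partial>Q\<bar>"
    using iff iklf by simp
  also have "\<dots> \<le> (\<integral>x. \<bar>k * l x * f (\<Phi> x) - f (\<Phi> x)\<bar> \<partial>Q)" by (rule integral_abs_bound)
  also have "\<dots> \<le> (\<integral>x. C * ((k - 1) * l x + (1 - l x)) \<partial>Q)"
  proof (rule integral_mono)
    fix x
    have "\<bar>k * l x * f (\<Phi> x) - f (\<Phi> x)\<bar> = \<bar>f (\<Phi> x)\<bar> * \<bar>(k - 1) * l x - (1 - l x)\<bar>"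
      by (simp add: abs_mult[symmetric] algebra_simps)
    also have "\<dots> \<le> C * ((k - 1) * l x + (1 - l x))"
      using C[of "\<Phi> x"] l[of x] k1 mult_nonneg_nonneg[of "k - 1" "l x"]
      by (intro mult_mono) (auto simp: abs_le_iff)
    finally show "\<bar>k * l x * f (\<Phi> x) - f (\<Phi> x)\<bar> \<le> C * ((k - 1) * l x + (1 - l x))" .
  qed (use iff iklf il in auto)
  also have "\<dots> = C * ((k - 1) * L + (1 - L))"
    using il by (simp add: L_def Q.prob_space)
  also have "\<dots> = 2 * C * (1 - L)" using kL by (simp add: algebra_simps)
  also have "\<dots> = 2 * C * (\<integral>x. 1 - l x \<partial>Q)" using il by (simp add: L_def Q.prob_space)
  finally show ?thesis .
qed

section \<open>Comparison of the two ensembles\<close>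

lemma abs_power_minus_one_le:
  fixes \<delta> \<epsilon> :: real
  assumes "0 \<le> \<delta>" "\<delta> \<le> 2" "\<bar>\<delta> - 1\<bar> \<le> \<epsilon>"
  shows "\<bar>\<delta> ^ i - 1\<bar> \<le> real i * 2 ^ i * \<epsilon>"
proof (induction i)
  case (Suc i)
  have "\<bar>\<delta> ^ Suc i - 1\<bar> = \<bar>\<delta> * (\<delta> ^ i - 1) + (\<delta> - 1)\<bar>" by (simp add: algebra_simps)
  also have "\<dots> \<le> \<delta> * \<bar>\<delta> ^ i - 1\<bar> + \<bar>\<delta> - 1\<bar>"
    using abs_triangle_ineq[of "\<delta> * (\<delta> ^ i - 1)" "\<delta> - 1"] assms by (simp add: abs_mult)
  also have "\<dots> \<le> 2 * (real i * 2 ^ i * \<epsilon>) + \<epsilon>"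
    using assms Suc.IH by (intro add_mono mult_mono) auto
  also have "\<dots> \<le> 2 * (real i * 2 ^ i * \<epsilon>) + 2 ^ Suc i * \<epsilon>"
    using assms mult_right_mono[of 1 "2 ^ Suc i" \<epsilon>] by (simp add: one_le_power[of "2::real" "Suc i", simplified])
  finally show ?case by (simp add: algebra_simps)
qed simp

lemma measurable_centred_power_sums [measurable]:
  "centred_power_sums e \<gamma> s n \<in> borel_measurable (lebesgue_n n)"
proof (rule borel_measurable_euclidean_space[THEN iffD2], rule ballI)
  fix b :: "real ^ 'a" assume "b \<in> Basis"
  then obtain l where b: "b = axis l 1" by (auto simp: Basis_vec_def)
  have "(\<lambda>x. centred_power_sum \<gamma> s n x (e l)) \<in> borel_measurable (lebesgue_n n)"
    unfolding centred_power_sum_def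
  proof (intro borel_measurable_diff borel_measurable_sum borel_measurable_const borel_measurable_power
      borel_measurable_times)
    show "(\<lambda>x. x j) \<in> borel_measurable (lebesgue_n n)" if "j \<in> {1..n}" for j
      using measurable_component_singleton[of j "{1..n}" "\<lambda>_. lborel :: real measure"] that by auto
  qed
  then show "(\<lambda>x. centred_power_sums e \<gamma> s n x \<bullet> b) \<in> borel_measurable (lebesgue_n n)"
    by (simp add: b inner_axis centred_power_sums_def)
qed

lemma centred_power_sums_restrict:
  "centred_power_sums e \<gamma> s n (\<lambda>j\<in>{1..n}. x j) = centred_power_sums e \<gamma> s n (\<lambda>j. x j)"
  by (simp add: centred_power_sums_def centred_power_sum_def vec_eq_iff)

context jacobi_laguerre
begin

lemma measurable_transform [measurable]:
  "(\<lambda>x. \<lambda>i\<in>{1..n}. jacobi_of_laguerre (x i)) \<in> measurable (lebesgue_n n) (lebesgue_n n)"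
proof (rule measurable_restrict)
  fix i assume "i \<in> {1..n}"
  note [measurable] = measurable_coordinate[OF this]
  show "(\<lambda>x. jacobi_of_laguerre (x i)) \<in> measurable (lebesgue_n n) lborel"
    unfolding jacobi_of_laguerre_def by measurable
qed

lemma jacobi_expectation_close:
  fixes f :: "(nat \<Rightarrow> real) \<Rightarrow> real"
  assumes M: "prob_space M"
    and dist: "distributed M (lebesgue_n n) Lam (\<lambda>x. ennreal (jacobi_density \<beta> a a2 n x))"
    and f [measurable]: "f \<in> borel_measurable (lebesgue_n n)" and C: "\<And>x. \<bar>f x\<bar> \<le> C"
  shows "\<bar>(\<integral>\<omega>. f (Lam \<omega>) \<partial>M) - expectation (\<lambda>x. f (\<lambda>i\<in>{1..n}. jacobi_of_laguerre (x i)))\<bar>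
    \<le> C * moment 3 / (2 * A\<^sup>2)"
proof -
  have Lam [measurable]: "Lam \<in> measurable M (lebesgue_n n)"
    using dist by (rule distributed_measurable)
  define P where "P = distr M (lebesgue_n n) Lam"
  have [measurable_cong]: "sets P = sets (lebesgue_n n)" by (simp add: P_def)
  have "\<bar>(\<integral>y. f y \<partial>P) - expectation (\<lambda>x. f (\<lambda>i\<in>{1..n}. jacobi_of_laguerre (x i)))\<bar>
      \<le> 2 * C * expectation (\<lambda>x. 1 - tilt x)"
  proof (rule tilted_expectation[where K = "ennreal density_constant * partition_function"])
    show "prob_space P" unfolding P_def using M Lam by (rule prob_space.prob_space_distr)
    fix F :: "(nat \<Rightarrow> real) \<Rightarrow> ennreal" assume "F \<in> borel_measurable P"
    then have [measurable]: "F \<in> borel_measurable (lebesgue_n n)" by simp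
    have "(\<integral>\<^sup>+ y. F y \<partial>P) = (\<integral>\<^sup>+ x. ennreal (jacobi_density \<beta> a a2 n x) * F x \<partial>lebesgue_n n)"
      unfolding P_def by (subst nn_integral_distr, simp, simp)
        (rule distributed_nn_integral[OF dist, symmetric], simp)
    then show "(\<integral>\<^sup>+ y. F y \<partial>P) = ennreal density_constant * partition_function *
        (\<integral>\<^sup>+ x. F (\<lambda>i\<in>{1..n}. jacobi_of_laguerre (x i)) * ennreal (tilt x) \<partial>Q)"
      by (simp add: nn_integral_jacobi_eq_tilted_laguerre)
  qed (use C prob tilt_bounds in auto)
  also have "(\<integral>y. f y \<partial>P) = (\<integral>\<omega>. f (Lam \<omega>) \<partial>M)"
    unfolding P_def by (rule integral_distr) simp_all
  also have "2 * C * expectation (\<lambda>x. 1 - tilt x) \<le> 2 * C * (moment 3 / (4 * A\<^sup>2))"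
    using C[of undefined] by (intro mult_left_mono expectation_one_minus_tilt) auto
  also have "\<dots> = C * moment 3 / (2 * A\<^sup>2)" by simp
  finally show ?thesis .
qed

text \<open>Here \<open>\<delta> = \<rho> / (1 + r \<theta> / \<kappa>)\<close> with \<open>\<rho> = a2 / \<surd>(A B)\<close>, and \<open>A \<le> \<surd>(A B) \<le> B\<close>
  bounds the distance of \<open>\<rho>\<close> from \<open>1\<close>.\<close>

lemma jacobi_of_laguerre_ratio:
  assumes \<theta>: "0 \<le> \<theta>" and A_half: "a2 \<le> 2 * A"
  obtains \<delta> where "2 * a2 * jacobi_of_laguerre \<theta> = \<theta> * \<delta>" "0 \<le> \<delta>" "\<delta> \<le> 2"
    "\<bar>\<delta> - 1\<bar> \<le> (ens_p \<beta> n + a + \<theta>) / A"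
proof
  define \<rho> where "\<rho> = a2 / (B * r)"
  define h where "h = 1 + r * (\<theta> / \<kappa>)"
  define \<delta> where "\<delta> = \<rho> / h"
  have "A \<le> a2" using ens_p_ge_1 by (simp add: A_def)
  then have pos: "0 < A" "0 < B" "0 < r" "0 < a2" using A_le_B r_bounds by auto
  have Brr: "B * r * r = A" using pos by (simp add: r_def mult.assoc)
  have AB: "A \<le> B * r" "B * r \<le> B"
    using Brr r_bounds pos mult_left_mono[of r 1 "B * r"] mult_left_mono[of r 1 B] by auto
  have h: "1 \<le> h" using \<theta> r_bounds kappa_pos by (simp add: h_def)
  have "\<kappa> = 2 * (B * r) * (1 + r)" unfolding \<kappa>_def Brr[symmetric] by (simp add: algebra_simps)
  moreover have "1 + r \<noteq> 0" using pos by simp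
  ultimately have "(1 + r) * (\<theta> / \<kappa>) = \<theta> / (2 * (B * r))" by simp
  then have "jacobi_of_laguerre \<theta> = \<theta> / (2 * (B * r)) / h"
    unfolding jacobi_of_laguerre_def h_def by (rule arg_cong)
  then show "2 * a2 * jacobi_of_laguerre \<theta> = \<theta> * \<delta>"
    by (simp add: \<delta>_def \<rho>_def mult_ac)
  have \<rho>_pos: "0 \<le> \<rho>" using pos by (simp add: \<rho>_def)
  show "0 \<le> \<delta>" using \<rho>_pos h by (simp add: \<delta>_def)
  have "\<rho> \<le> a2 / A" unfolding \<rho>_def using AB pos by (intro divide_left_mono) auto
  moreover have "a2 / A \<le> 2" using A_half pos by (simp add: divide_le_eq)
  moreover have "a2 / A - 1 = (a2 - A) / A" using pos by (simp add: diff_divide_distrib)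
  moreover have "a2 - A = ens_p \<beta> n" by (simp add: A_def)
  ultimately have \<rho>_le: "\<rho> \<le> 2" "\<rho> - 1 \<le> ens_p \<beta> n / A" by simp_all
  have "\<delta> \<le> \<rho>" unfolding \<delta>_def using h \<rho>_pos by (simp add: divide_le_eq mult_left_mono[of 1 h \<rho>, simplified])
  with \<rho>_le show "\<delta> \<le> 2" by simp
  have "a2 / B \<le> \<rho>" unfolding \<rho>_def using AB pos by (intro divide_left_mono) auto
  moreover have "1 - a2 / B = a / B" using pos by (simp add: B_def field_simps)
  moreover have "a / B \<le> a / A" using A_le_B pos a_pos by (intro divide_left_mono) auto
  ultimately have \<rho>_ge: "1 - \<rho> \<le> a / A" by linarith
  have p_nonneg: "0 \<le> ens_p \<beta> n" using ens_p_ge_1 by simp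
  have "\<delta> - 1 = (\<rho> - h) / h" using h by (simp add: \<delta>_def diff_divide_distrib)
  then have "\<bar>\<delta> - 1\<bar> = \<bar>\<rho> - h\<bar> / h" using h by simp
  also have "\<dots> \<le> \<bar>\<rho> - h\<bar>" using h mult_left_mono[of 1 h "\<bar>\<rho> - h\<bar>"] by (simp add: divide_le_eq)
  also have "\<dots> \<le> \<bar>\<rho> - 1\<bar> + r * (\<theta> / \<kappa>)"
    using \<theta> pos kappa_pos unfolding h_def by (smt (verit) divide_nonneg_nonneg mult_nonneg_nonneg)
  also have "\<dots> \<le> (ens_p \<beta> n + a) / A + \<theta> / A"
  proof (rule add_mono)
    have "0 \<le> ens_p \<beta> n / A" "0 \<le> a / A" using p_nonneg a_pos pos by auto
    then show "\<bar>\<rho> - 1\<bar> \<le> (ens_p \<beta> n + a) / A" using \<rho>_le \<rho>_ge by (simp add: add_divide_distrib abs_le_iff)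
    have "r * (\<theta> / \<kappa>) \<le> 1 * (\<theta> / A)"
      using \<theta> r_bounds pos kappa_ge kappa_pos by (intro mult_mono divide_left_mono) auto
    then show "r * (\<theta> / \<kappa>) \<le> \<theta> / A" by simp
  qed
  finally show "\<bar>\<delta> - 1\<bar> \<le> (ens_p \<beta> n + a + \<theta>) / A" by (simp add: add_divide_distrib)
qed

lemma centred_power_sum_close:
  assumes s: "0 \<le> s" and x: "\<forall>i\<in>{1..n}. 0 \<le> x i" and A_half: "a2 \<le> 2 * A"
  shows "\<bar>centred_power_sum \<gamma> (s * (2 * a2)) n (\<lambda>j\<in>{1..n}. jacobi_of_laguerre (x j)) i - centred_power_sum \<gamma> s n x i\<bar> \<le>
    s ^ i * (real i * 2 ^ i) / A *
      ((ens_p \<beta> n + a) * (\<Sum>j\<in>{1..n}. x j ^ i) + (\<Sum>j\<in>{1..n}. x j ^ Suc i))"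
proof -
  have "\<bar>centred_power_sum \<gamma> (s * (2 * a2)) n (\<lambda>j\<in>{1..n}. jacobi_of_laguerre (x j)) i - centred_power_sum \<gamma> s n x i\<bar> =
     \<bar>\<Sum>j\<in>{1..n}. (s * (2 * a2 * jacobi_of_laguerre (x j))) ^ i - (s * x j) ^ i\<bar>"
    by (simp add: centred_power_sum_def sum_subtractf mult.assoc)
  also have "\<dots> \<le> (\<Sum>j\<in>{1..n}. \<bar>(s * (2 * a2 * jacobi_of_laguerre (x j))) ^ i - (s * x j) ^ i\<bar>)"
    by (rule sum_abs)
  also have "\<dots> \<le> (\<Sum>j\<in>{1..n}. s ^ i * (real i * 2 ^ i) / A * ((ens_p \<beta> n + a) * x j ^ i + x j ^ Suc i))"
  proof (rule sum_mono)
    fix j assume "j \<in> {1..n}"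
    then have xj: "0 \<le> x j" using x by simp
    obtain \<delta> where \<delta>: "2 * a2 * jacobi_of_laguerre (x j) = x j * \<delta>" "0 \<le> \<delta>" "\<delta> \<le> 2"
      "\<bar>\<delta> - 1\<bar> \<le> (ens_p \<beta> n + a + x j) / A"
      by (rule jacobi_of_laguerre_ratio[OF xj A_half])
    have "\<bar>(s * (2 * a2 * jacobi_of_laguerre (x j))) ^ i - (s * x j) ^ i\<bar> = \<bar>(s * x j) ^ i * (\<delta> ^ i - 1)\<bar>"
      unfolding \<delta>(1) by (simp add: power_mult_distrib algebra_simps)
    also have "\<dots> = (s * x j) ^ i * \<bar>\<delta> ^ i - 1\<bar>" using s xj by (simp add: abs_mult)
    also have "\<dots> \<le> (s * x j) ^ i * (real i * 2 ^ i * ((ens_p \<beta> n + a + x j) / A))"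
      using s xj by (intro mult_left_mono abs_power_minus_one_le \<delta>) auto
    also have "\<dots> = s ^ i * (real i * 2 ^ i) / A * ((ens_p \<beta> n + a) * x j ^ i + x j ^ Suc i)"
      by (simp add: power_mult_distrib algebra_simps add_divide_distrib)
    finally show "\<bar>(s * (2 * a2 * jacobi_of_laguerre (x j))) ^ i - (s * x j) ^ i\<bar> \<le>
        s ^ i * (real i * 2 ^ i) / A * ((ens_p \<beta> n + a) * x j ^ i + x j ^ Suc i)" .
  qed
  also have "\<dots> = s ^ i * (real i * 2 ^ i) / A *
      ((ens_p \<beta> n + a) * (\<Sum>j\<in>{1..n}. x j ^ i) + (\<Sum>j\<in>{1..n}. x j ^ Suc i))"
    by (simp only: sum_distrib_left[symmetric] sum.distrib)
  finally show ?thesis .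
qed

lemma centred_power_sums_close:
  fixes e :: "'k::finite \<Rightarrow> nat" and \<gamma> :: real
  assumes s: "0 \<le> s" and A_half: "a2 \<le> 2 * A"
  defines "D \<equiv> \<lambda>x. norm (centred_power_sums e \<gamma> (s * (2 * a2)) n (\<lambda>j\<in>{1..n}. jacobi_of_laguerre (x j)) -
      centred_power_sums e \<gamma> s n x)"
  shows "integrable Q D"
    and "expectation D \<le> (\<Sum>l\<in>UNIV. s ^ e l * (real (e l) * 2 ^ e l) / A *
      ((ens_p \<beta> n + a) * moment (e l) + moment (Suc (e l))))"
proof -
  let ?H = "\<lambda>x. \<Sum>l\<in>UNIV. s ^ e l * (real (e l) * 2 ^ e l) / A *
      ((ens_p \<beta> n + a) * (\<Sum>j\<in>{1..n}. x j ^ e l) + (\<Sum>j\<in>{1..n}. x j ^ Suc (e l)))"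
  have iH: "integrable Q ?H"
    by (intro Bochner_Integration.integrable_sum integrable_mult_right Bochner_Integration.integrable_add
        integrable_power_sum)
  have bound: "AE x in Q. D x \<le> ?H x"
    using AE_Q_nonneg
  proof eventually_elim
    case (elim x)
    show ?case
      unfolding D_def
      by (rule order_trans[OF norm_le_l1_cart sum_mono])
         (simp only: centred_power_sums_def vector_minus_component vec_lambda_beta,
           rule centred_power_sum_close[OF s elim A_half])
  qed
  have [measurable]: "D \<in> borel_measurable (lebesgue_n n)"
    unfolding D_def by measurable
  have D_nonneg: "0 \<le> D x" for x by (simp add: D_def)
  show iD: "integrable Q D"
    using iH
  proof (rule Bochner_Integration.integrable_bound)
    show "AE x in Q. norm (D x) \<le> norm (?H x)"
      using bound by eventually_elim (use D_nonneg in force)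
  qed simp
  have "expectation D \<le> expectation ?H"
    using iD iH bound by (rule integral_mono_AE)
  also have "\<dots> = (\<Sum>l\<in>UNIV. s ^ e l * (real (e l) * 2 ^ e l) / A *
      ((ens_p \<beta> n + a) * moment (e l) + moment (Suc (e l))))"
    unfolding moment_def
    by (subst Bochner_Integration.integral_sum)
       (auto simp: integrable_power_sum simp del: power_Suc sum.cl_ivl_Suc
         intro!: integrable_mult_right Bochner_Integration.integrable_add)
  finally show "expectation D \<le> (\<Sum>l\<in>UNIV. s ^ e l * (real (e l) * 2 ^ e l) / A *
      ((ens_p \<beta> n + a) * moment (e l) + moment (Suc (e l))))" .
qed

end

text \<open>The mass is \<open>Z / Z\<close> for the integral \<open>Z\<close> of the weight, and \<open>0 / 0 = \<infinity> / \<infinity> = 0\<close>.\<close>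

lemma laguerre_ensemble_mass:
  "emeasure (laguerre_ensemble \<beta> a n) (space (laguerre_ensemble \<beta> a n)) \<in> {0, 1}"
proof -
  let ?Z = "\<integral>\<^sup>+ y. ennreal (laguerre_weight \<beta> a n y) \<partial>lebesgue_n n"
  have "emeasure (laguerre_ensemble \<beta> a n) (space (laguerre_ensemble \<beta> a n)) =
      (\<integral>\<^sup>+ x. ennreal (laguerre_weight \<beta> a n x) / ?Z \<partial>lebesgue_n n)"
    unfolding laguerre_ensemble_def
    by (subst emeasure_density) (auto intro!: nn_integral_cong)
  also have "\<dots> = ?Z / ?Z" by (rule nn_integral_divide) measurable
  also have "\<dots> \<in> {0, 1}"
    by (cases "?Z = 0 \<or> ?Z = \<infinity>") (auto simp: ennreal_divide_self top.not_eq_extremum)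
  finally show ?thesis .
qed

text \<open>Testing the convergence against the constant \<open>1\<close>: the masses tend to \<open>1\<close>, and they are \<open>0\<close> or \<open>1\<close>.  The
  finiteness of the Laguerre partition functions is thus a consequence of the limit theorem.\<close>

lemma eventually_laguerre_prob_space:
  assumes N: "prob_space N"
    and conv: "weakly_converges (\<lambda>n. distr (laguerre_ensemble \<beta> (a n) n) borel (Y n)) N"
    and Y: "\<And>n. Y n \<in> borel_measurable (lebesgue_n n)"
  shows "eventually (\<lambda>n. prob_space (laguerre_ensemble \<beta> (a n) n)) sequentially"
proof -
  interpret N: prob_space N by fact
  let ?L = "\<lambda>n. laguerre_ensemble \<beta> (a n) n"
  have "(\<lambda>n. \<integral>x. (1::real) \<partial>distr (?L n) borel (Y n)) \<longlonglongrightarrow> (\<integral>x. 1 \<partial>N)"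
  proof -
    have "continuous_on UNIV (\<lambda>_::'a. 1::real)" "bounded (range (\<lambda>_::'a. 1::real))" by auto
    then show ?thesis using conv unfolding weakly_converges_def by blast
  qed
  moreover have "(\<integral>x. (1::real) \<partial>distr (?L n) borel (Y n)) = measure (?L n) (space (?L n))" for n
    using Y[of n] by (subst integral_distr) (simp_all add: laguerre_ensemble_def)
  ultimately have "(\<lambda>n. measure (?L n) (space (?L n))) \<longlonglongrightarrow> 1" by (simp add: N.prob_space)
  then have "eventually (\<lambda>n. measure (?L n) (space (?L n)) > 0) sequentially"
    by (rule order_tendstoD(1)) simp
  then show ?thesis
  proof eventually_elim
    case (elim n)
    then have "emeasure (?L n) (space (?L n)) = 1"
      using laguerre_ensemble_mass[of \<beta> "a n" n] by (auto simp: measure_def)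
    then show ?case by (rule prob_spaceI)
  qed
qed

section \<open>The asymptotic regime\<close>

definition moment_rate_constant :: "real \<Rightarrow> real \<Rightarrow> nat \<Rightarrow> real" where
  "moment_rate_constant \<beta> c0 m = moment_constant \<beta> m * c0 ^ m"

lemma moment_rate_constant_nonneg: "0 \<le> \<beta> \<Longrightarrow> 0 \<le> c0 \<Longrightarrow> 0 \<le> moment_rate_constant \<beta> c0 m"
  by (simp add: moment_rate_constant_def moment_constant_nonneg)

definition power_sum_rate_constant :: "('k::finite \<Rightarrow> nat) \<Rightarrow> real \<Rightarrow> real \<Rightarrow> real \<Rightarrow> real" where
  "power_sum_rate_constant e \<beta> \<gamma> c0 = (\<Sum>l\<in>UNIV. (\<gamma> / \<beta>) ^ e l * (real (e l) * 2 ^ e l) * 2 *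
      (2 * c0 * moment_rate_constant \<beta> c0 (e l) + moment_rate_constant \<beta> c0 (Suc (e l))))"

text \<open>The regime of the theorem for a single \<open>n\<close>: the Laguerre parameter is at most of order \<open>n\<close>, and
  \<open>a2\<close> dominates \<open>n\<close>.  The rates below are explicit in \<open>n\<^sup>2 / a2\<close>, with constants that do not
  depend on \<open>n\<close>, \<open>a\<close> and \<open>a2\<close>; this uniformity is what the limit needs.\<close>

locale jacobi_laguerre_regime = jacobi_laguerre \<beta> a n a2 for \<beta> a n a2 +
  fixes c0 :: real
  assumes a2_le: "a2 \<le> 2 * (a2 - ens_p \<beta> n)"
    and size: "real n + a + 1 \<le> c0 * real n"
begin

lemma c0_pos: "0 < c0"
proof -
  have "0 < c0 * real n" using size a_pos by linarith
  then show ?thesis using n_pos by (simp add: zero_less_mult_iff)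
qed

lemma A_half: "a2 \<le> 2 * A"
  using a2_le by (simp add: A_def)

lemma a2_pos: "0 < a2"
  using A_le_B(1) ens_p_ge_1 by (simp add: A_def)

lemma ens_p_plus_a_le: "ens_p \<beta> n + a \<le> 2 * (c0 * real n)"
proof -
  have "ens_p \<beta> n \<le> a + 1" using a_large by (simp add: ens_p_def)
  then show ?thesis using size a_pos by simp
qed

lemma moment_rate: "moment m \<le> moment_rate_constant \<beta> c0 m * real n ^ Suc m"
proof -
  have "moment_constant \<beta> m * real n * (real n + a + 1) ^ m \<le> moment_constant \<beta> m * real n * (c0 * real n) ^ m"
    using size a_pos beta_pos
    by (intro mult_left_mono power_mono mult_nonneg_nonneg moment_constant_nonneg) auto
  then show ?thesis
    using moment_bound[of m] by (simp add: moment_rate_constant_def power_mult_distrib mult_ac)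
qed

lemma jacobi_expectation_rate:
  fixes f :: "(nat \<Rightarrow> real) \<Rightarrow> real"
  assumes "prob_space M"
    and "distributed M (lebesgue_n n) Lam (\<lambda>x. ennreal (jacobi_density \<beta> a a2 n x))"
    and "f \<in> borel_measurable (lebesgue_n n)" and C: "\<And>x. \<bar>f x\<bar> \<le> C"
  shows "\<bar>(\<integral>\<omega>. f (Lam \<omega>) \<partial>M) - expectation (\<lambda>x. f (\<lambda>i\<in>{1..n}. jacobi_of_laguerre (x i)))\<bar>
    \<le> 2 * C * moment_rate_constant \<beta> c0 3 * ((real n)\<^sup>2 / a2)\<^sup>2"
proof -
  have C_nonneg: "0 \<le> C" using C[of undefined] by linarith
  have "\<bar>(\<integral>\<omega>. f (Lam \<omega>) \<partial>M) - expectation (\<lambda>x. f (\<lambda>i\<in>{1..n}. jacobi_of_laguerre (x i)))\<bar>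
      \<le> C * moment 3 / (2 * A\<^sup>2)"
    by (rule jacobi_expectation_close[OF assms])
  also have "\<dots> \<le> C * (moment_rate_constant \<beta> c0 3 * real n ^ 4) / (2 * (a2 / 2)\<^sup>2)"
  proof (rule frac_le)
    show "C * moment 3 \<le> C * (moment_rate_constant \<beta> c0 3 * real n ^ 4)"
      using moment_rate[of 3] C_nonneg by (intro mult_left_mono) auto
    show "2 * (a2 / 2)\<^sup>2 \<le> 2 * A\<^sup>2"
      using A_half a2_pos by (intro mult_left_mono power_mono) auto
  qed (use C_nonneg beta_pos c0_pos a2_pos moment_rate_constant_nonneg in auto)
  also have "\<dots> = 2 * C * moment_rate_constant \<beta> c0 3 * ((real n)\<^sup>2 / a2)\<^sup>2"
    by (simp add: power_divide power_mult[symmetric])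
  finally show ?thesis .
qed

lemma centred_power_sums_rate:
  fixes e :: "'k::finite \<Rightarrow> nat" and \<gamma> :: real
  assumes \<gamma>: "0 < \<gamma>"
  defines "s \<equiv> \<gamma> / (real n * \<beta>)"
  shows "expectation (\<lambda>x. norm (centred_power_sums e \<gamma> (s * (2 * a2)) n (\<lambda>j\<in>{1..n}. jacobi_of_laguerre (x j)) -
      centred_power_sums e \<gamma> s n x)) \<le> power_sum_rate_constant e \<beta> \<gamma> c0 * ((real n)\<^sup>2 / a2)"
proof -
  let ?D = "moment_rate_constant \<beta> c0"
  have s_nonneg: "0 \<le> s" using \<gamma> beta_pos by (simp add: s_def)
  have "expectation (\<lambda>x. norm (centred_power_sums e \<gamma> (s * (2 * a2)) n (\<lambda>j\<in>{1..n}. jacobi_of_laguerre (x j)) -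
      centred_power_sums e \<gamma> s n x)) \<le> (\<Sum>l\<in>UNIV. s ^ e l * (real (e l) * 2 ^ e l) / A *
      ((ens_p \<beta> n + a) * moment (e l) + moment (Suc (e l))))"
    by (rule centred_power_sums_close(2)[OF s_nonneg A_half])
  also have "\<dots> \<le> (\<Sum>l\<in>UNIV. (\<gamma> / \<beta>) ^ e l * (real (e l) * 2 ^ e l) * 2 *
      (2 * c0 * ?D (e l) + ?D (Suc (e l))) * ((real n)\<^sup>2 / a2))"
  proof (rule sum_mono)
    fix l :: 'k
    let ?i = "e l"
    have "(ens_p \<beta> n + a) * moment ?i + moment (Suc ?i) \<le>
        2 * (c0 * real n) * (?D ?i * real n ^ Suc ?i) + ?D (Suc ?i) * real n ^ Suc (Suc ?i)"
      using ens_p_plus_a_le c0_pos by (intro add_mono mult_mono moment_rate moment_nonneg) auto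
    also have "\<dots> = real n ^ ?i * (real n)\<^sup>2 * (2 * c0 * ?D ?i + ?D (Suc ?i))"
      by (simp add: power2_eq_square algebra_simps)
    finally have 1: "(ens_p \<beta> n + a) * moment ?i + moment (Suc ?i) \<le>
        real n ^ ?i * (real n)\<^sup>2 * (2 * c0 * ?D ?i + ?D (Suc ?i))" .
    have "1 / A \<le> 2 / a2" using A_half A_le_B a2_pos by (simp add: field_simps)
    then have 2: "s ^ ?i * (real ?i * 2 ^ ?i) / A \<le> s ^ ?i * (real ?i * 2 ^ ?i) * (2 / a2)"
      using s_nonneg mult_left_mono[of "1 / A" "2 / a2" "s ^ ?i * (real ?i * 2 ^ ?i)"] by simp
    have "s ^ ?i * (real ?i * 2 ^ ?i) / A * ((ens_p \<beta> n + a) * moment ?i + moment (Suc ?i)) \<le>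
        s ^ ?i * (real ?i * 2 ^ ?i) * (2 / a2) * (real n ^ ?i * (real n)\<^sup>2 * (2 * c0 * ?D ?i + ?D (Suc ?i)))"
    proof (rule mult_mono[OF 2 1])
      show "0 \<le> s ^ ?i * (real ?i * 2 ^ ?i) * (2 / a2)" using s_nonneg a2_pos by simp
      have "0 \<le> ens_p \<beta> n + a" using a_pos ens_p_ge_1 by simp
      then show "0 \<le> (ens_p \<beta> n + a) * moment ?i + moment (Suc ?i)"
        by (rule add_nonneg_nonneg[OF mult_nonneg_nonneg[OF _ moment_nonneg] moment_nonneg])
    qed
    also have "\<dots> = (s * real n) ^ ?i * (real ?i * 2 ^ ?i) * 2 *
        (2 * c0 * ?D ?i + ?D (Suc ?i)) * ((real n)\<^sup>2 / a2)"
      by (simp add: power_mult_distrib)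
    also have "s * real n = \<gamma> / \<beta>" using n_pos by (simp add: s_def)
    finally show "s ^ ?i * (real ?i * 2 ^ ?i) / A * ((ens_p \<beta> n + a) * moment ?i + moment (Suc ?i)) \<le>
        (\<gamma> / \<beta>) ^ ?i * (real ?i * 2 ^ ?i) * 2 * (2 * c0 * ?D ?i + ?D (Suc ?i)) * ((real n)\<^sup>2 / a2)" .
  qed
  finally show ?thesis unfolding power_sum_rate_constant_def sum_distrib_right .
qed

end

lemma eventually_jacobi_laguerre_regime:
  fixes a1 a2 :: "nat \<Rightarrow> real"
  assumes \<beta>: "0 < \<beta>" and \<gamma>: "0 < \<gamma>"
    and a1: "\<And>n. n \<ge> 2 \<Longrightarrow> \<beta> / 2 * (real n - 1) < a1 n"
    and a2: "eventually (\<lambda>n. 0 < a2 n) sequentially"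
    and ratio: "(\<lambda>n. real n * \<beta> / (2 * a1 n)) \<longlonglongrightarrow> \<gamma>"
    and small: "(\<lambda>n. (real n)\<^sup>2 / a2 n) \<longlonglongrightarrow> 0"
    and prob: "eventually (\<lambda>n. prob_space (laguerre_ensemble \<beta> (a1 n) n)) sequentially"
  shows "eventually (\<lambda>n. jacobi_laguerre_regime \<beta> (a1 n) n (a2 n) (2 + \<beta> / \<gamma>)) sequentially"
proof -
  have "eventually (\<lambda>n. \<gamma> / 2 < real n * \<beta> / (2 * a1 n)) sequentially"
    using \<gamma> by (intro order_tendstoD(1)[OF ratio]) simp
  \<comment> \<open>\<open>n\<^sup>2 (\<beta> + 10) \<le> a2\<close> leaves room for \<open>2 (p + 4) \<le> 2 + n \<beta> + 8 \<le> n \<beta> + 10 n\<close>.\<close>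
  moreover have "eventually (\<lambda>n. (real n)\<^sup>2 / a2 n < 1 / (\<beta> + 10)) sequentially"
    using \<beta> by (intro order_tendstoD(2)[OF small]) simp
  ultimately show ?thesis
    using prob a2 eventually_ge_at_top[of 2]
  proof eventually_elim
    case (elim n)
    have a1_large: "\<beta> / 2 * (real n - 1) < a1 n" by (rule a1) fact
    have n_term: "0 \<le> \<beta> / 2 * (real n - 1)" using elim \<beta> by simp
    with a1_large have a1_pos: "0 < a1 n" by linarith
    have "1 \<le> ens_p \<beta> n" using n_term by (simp add: ens_p_def)
    note p_nonneg = order_trans[OF zero_le_one this]
    have "\<gamma> * a1 n \<le> real n * \<beta>" using elim(1) a1_pos by (simp add: field_simps)
    then have "a1 n \<le> \<beta> / \<gamma> * real n" using \<gamma> by (simp add: field_simps)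
    then have size: "real n + a1 n + 1 \<le> (2 + \<beta> / \<gamma>) * real n" using elim by (simp add: algebra_simps)
    have "(real n)\<^sup>2 * (\<beta> + 10) \<le> a2 n"
      using elim \<beta> by (simp add: field_simps)
    moreover have "real n * (\<beta> + 10) \<le> (real n)\<^sup>2 * (\<beta> + 10)"
      using elim \<beta> by (intro mult_right_mono) (auto simp: power2_eq_square)
    ultimately have "real n * \<beta> + 10 * real n \<le> a2 n" by (simp add: algebra_simps)
    moreover have "2 * ens_p \<beta> n \<le> 2 + real n * \<beta>"
      using \<beta> by (simp add: ens_p_def algebra_simps)
    ultimately have p: "2 * (ens_p \<beta> n + 4) \<le> a2 n" using elim by simp
    show ?case
      using elim(5) p p_nonneg size
      by (intro jacobi_laguerre_regime.intro jacobi_laguerre_regime_axioms.intro jacobi_laguerre.intro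
          laguerre_prob.intro jacobi_laguerre_axioms.intro \<beta> a1_large elim(3)) auto
  qed
qed

section \<open>The central limit theorem for the Jacobi ensemble\<close>

theorem theorem3:
  fixes \<beta> \<gamma> :: real
    and a1 a2 :: "nat \<Rightarrow> real"
    and M :: "nat \<Rightarrow> 'w measure"
    and lam :: "nat \<Rightarrow> nat \<Rightarrow> 'w \<Rightarrow> real"
    and e :: "'k::finite \<Rightarrow> nat"
    and \<mu> :: "real ^ 'k"
    and \<Sigma> :: "real ^ 'k ^ 'k"
  assumes "\<beta> > 0"
    and "0 < \<gamma>" and "\<gamma> \<le> 1"
    and "\<And>n. n \<ge> 2 \<Longrightarrow> a1 n > \<beta> / 2 * (real n - 1)"
    and "\<And>n. n \<ge> 2 \<Longrightarrow> a2 n > \<beta> / 2 * (real n - 1)"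
    and "\<And>n. n \<ge> 2 \<Longrightarrow> prob_space (M n)"
    and "\<And>n. n \<ge> 2 \<Longrightarrow>
           distributed (M n) (lebesgue_n n) (\<lambda>\<omega>. \<lambda>j\<in>{1..n}. lam n j \<omega>)
             (\<lambda>x. ennreal (jacobi_density \<beta> (a1 n) (a2 n) n x))"
    and "filterlim a1 at_top sequentially"
    and "filterlim a2 at_top sequentially"
    and "a1 \<in> o(\<lambda>n. sqrt (a2 n))"
    and "(\<lambda>n. real n) \<in> o(\<lambda>n. sqrt (a2 n))"
    and "(\<lambda>n. real n * \<beta> / (2 * a1 n)) \<longlonglongrightarrow> \<gamma>"
    and "bij_betw e UNIV {1..CARD('k)}"
    and "laguerre_clt_parameters e \<beta> \<gamma> a1 \<mu> \<Sigma>"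
  defines "c \<equiv> 2 * \<gamma> / \<beta>"
  shows "converges_to_normal
           (\<lambda>n. distr (M n) borel
              (\<lambda>\<omega>. centred_power_sums e \<gamma> (c * a2 n / real n) n (\<lambda>j. lam n j \<omega>))) \<mu> \<Sigma>"
proof -
  obtain N where N: "multivariate_normal \<mu> \<Sigma> N"
    and conv: "weakly_converges (\<lambda>n. distr (laguerre_ensemble \<beta> (a1 n) n) borel
              (centred_power_sums e \<gamma> (\<gamma> / (real n * \<beta>)) n)) N"
    using assms(14) unfolding laguerre_clt_parameters_def converges_to_normal_def by blast
  note N_prob = multivariate_normal_prob[OF N]
  define b where "b n = (real n)\<^sup>2 / a2 n" for n
  have a2_pos: "eventually (\<lambda>n. 0 < a2 n) sequentially"
    using assms(9) by (simp add: filterlim_at_top_dense)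
  have b_0: "b \<longlonglongrightarrow> 0"
  proof -
    have "(\<lambda>n. (real n / sqrt (a2 n))\<^sup>2) \<longlonglongrightarrow> 0\<^sup>2"
      by (intro tendsto_power smalloD_tendsto assms(11))
    moreover have "eventually (\<lambda>n. (real n / sqrt (a2 n))\<^sup>2 = b n) sequentially"
      using a2_pos by eventually_elim (simp add: b_def power_divide)
    ultimately show ?thesis by (simp add: tendsto_cong)
  qed
  define c0 where "c0 = 2 + \<beta> / \<gamma>"
  have "eventually (\<lambda>n. prob_space (laguerre_ensemble \<beta> (a1 n) n)) sequentially"
    by (rule eventually_laguerre_prob_space[OF N_prob(1) conv]) measurable
  then have "eventually (\<lambda>n. jacobi_laguerre_regime \<beta> (a1 n) n (a2 n) c0) sequentially"
    unfolding c0_def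
    by (intro eventually_jacobi_laguerre_regime assms(1,2,4,12) a2_pos b_0[unfolded b_def])
  then have "eventually (\<lambda>n. 2 \<le> n \<and> jacobi_laguerre_regime \<beta> (a1 n) n (a2 n) c0) sequentially"
    using eventually_ge_at_top[of 2] by eventually_elim simp
  then obtain n0 where n0: "\<And>n. n0 \<le> n \<Longrightarrow> 2 \<le> n"
      "\<And>n. n0 \<le> n \<Longrightarrow> jacobi_laguerre_regime \<beta> (a1 n) n (a2 n) c0"
    unfolding eventually_sequentially by blast
  define s where "s n = \<gamma> / (real n * \<beta>)" for n
  define L where "L n = laguerre_ensemble \<beta> (a1 n) n" for n
  \<comment> \<open>On the Laguerre space, \<open>Y n\<close> is the vector of the Laguerre theorem and \<open>X n\<close> is the vector of
    the Jacobi theorem read through the coupling map.\<close>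
  define X where "X n x = centred_power_sums e \<gamma> (s n * (2 * a2 n)) n
      (\<lambda>j\<in>{1..n}. jacobi_laguerre.jacobi_of_laguerre \<beta> (a1 n) n (a2 n) (x j))" for n x
  define Y where "Y n = centred_power_sums e \<gamma> (s n) n" for n
  define E where "E = power_sum_rate_constant e \<beta> \<gamma> c0"
  have X_Y: "prob_space (L n)" "X n \<in> borel_measurable (L n)" "Y n \<in> borel_measurable (L n)"
      "integrable (L n) (\<lambda>x. norm (X n x - Y n x))"
      "(\<integral>x. norm (X n x - Y n x) \<partial>L n) \<le> E * b n" if n: "n0 \<le> n" for n
  proof -
    interpret jacobi_laguerre_regime \<beta> "a1 n" n "a2 n" c0 by (rule n0(2)[OF n])
    have s_nonneg: "0 \<le> s n" using assms(1,2) by (simp add: s_def)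
    show "prob_space (L n)" unfolding L_def by (rule prob)
    show "X n \<in> borel_measurable (L n)" "Y n \<in> borel_measurable (L n)"
      unfolding X_def Y_def L_def by measurable
    show "integrable (L n) (\<lambda>x. norm (X n x - Y n x))"
      using centred_power_sums_close(1)[OF s_nonneg A_half, of e \<gamma>] unfolding L_def X_def Y_def .
    show "(\<integral>x. norm (X n x - Y n x) \<partial>L n) \<le> E * b n"
      using centred_power_sums_rate[OF assms(2), of e] unfolding L_def X_def Y_def s_def E_def b_def .
  qed
  have convX: "weakly_converges (\<lambda>n. distr (L n) borel (X n)) N"
  proof (rule weakly_converges_distr_perturb[OF N_prob, where Y = Y])
    show "weakly_converges (\<lambda>n. distr (L n) borel (Y n)) N"
      using conv unfolding L_def Y_def s_def .
    show "(\<lambda>n. \<integral>x. norm (X n x - Y n x) \<partial>L n) \<longlonglongrightarrow> 0"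
    proof (rule real_tendsto_sandwich[of "\<lambda>_. 0" _ _ "\<lambda>n. E * b n"])
      show "(\<lambda>n. E * b n) \<longlonglongrightarrow> 0" using tendsto_mult_left[OF b_0, of E] by simp
      show "eventually (\<lambda>n. (\<integral>x. norm (X n x - Y n x) \<partial>L n) \<le> E * b n) sequentially"
        using eventually_ge_at_top[of n0] by eventually_elim (rule X_Y)
    qed auto
  qed (use X_Y in auto)
  have "weakly_converges (\<lambda>n. distr (M n) borel
      (\<lambda>\<omega>. centred_power_sums e \<gamma> (c * a2 n / real n) n (\<lambda>j. lam n j \<omega>))) N"
    unfolding weakly_converges_def
  proof (intro allI impI, elim conjE)
    fix f :: "real ^ 'k \<Rightarrow> real" assume f: "continuous_on UNIV f" "bounded (range f)"
    have f_meas [measurable]: "f \<in> borel_measurable borel" by (rule borel_measurable_continuous_onI[OF f(1)])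
    obtain C where C: "\<And>x. \<bar>f x\<bar> \<le> C" using f(2) unfolding bounded_iff by auto
    define K where "K = 2 * C * moment_rate_constant \<beta> c0 3"
    let ?J = "\<lambda>n. \<integral>y. f y \<partial>distr (M n) borel (\<lambda>\<omega>. centred_power_sums e \<gamma> (c * a2 n / real n) n (\<lambda>j. lam n j \<omega>))"
    let ?I = "\<lambda>n. \<integral>y. f y \<partial>distr (L n) borel (X n)"
    have close: "\<bar>?J n - ?I n\<bar> \<le> K * (b n)\<^sup>2" if n: "n0 \<le> n" for n
    proof -
      interpret jacobi_laguerre_regime \<beta> "a1 n" n "a2 n" c0 by (rule n0(2)[OF n])
      have n2: "2 \<le> n" by (rule n0(1)[OF n])
      let ?Lam = "\<lambda>\<omega>. \<lambda>j\<in>{1..n}. lam n j \<omega>"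
      let ?F = "\<lambda>x. f (centred_power_sums e \<gamma> (s n * (2 * a2 n)) n x)"
      have scale: "c * a2 n / real n = s n * (2 * a2 n)" by (simp add: c_def s_def mult_ac)
      have Lam: "?Lam \<in> measurable (M n) (lebesgue_n n)"
        using assms(7)[OF n2] by (rule distributed_measurable)
      have cps: "(\<lambda>\<omega>. centred_power_sums e \<gamma> (s n * (2 * a2 n)) n (\<lambda>j. lam n j \<omega>)) =
          (\<lambda>\<omega>. centred_power_sums e \<gamma> (s n * (2 * a2 n)) n (?Lam \<omega>))"
        by (simp only: centred_power_sums_restrict)
      have "?J n = (\<integral>\<omega>. ?F (?Lam \<omega>) \<partial>M n)"
        unfolding scale cps
        by (rule integral_distr[OF measurable_compose[OF Lam measurable_centred_power_sums] f_meas])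
      moreover have "?I n = expectation (\<lambda>x. ?F (\<lambda>i\<in>{1..n}. jacobi_of_laguerre (x i)))"
        using integral_distr[OF X_Y(2)[OF n] f_meas] unfolding L_def X_def .
      moreover have "\<bar>(\<integral>\<omega>. ?F (?Lam \<omega>) \<partial>M n) - expectation (\<lambda>x. ?F (\<lambda>i\<in>{1..n}. jacobi_of_laguerre (x i)))\<bar>
          \<le> K * (b n)\<^sup>2"
        unfolding K_def b_def using C by (intro jacobi_expectation_rate assms(6,7) n2) auto
      ultimately show ?thesis by simp
    qed
    have "(\<lambda>n. ?J n - ?I n) \<longlonglongrightarrow> 0"
    proof (rule Lim_null_comparison)
      show "eventually (\<lambda>n. norm (?J n - ?I n) \<le> K * (b n)\<^sup>2) sequentially"
        using eventually_ge_at_top[of n0] by eventually_elim (use close in simp)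
      have "(\<lambda>n. K * (b n)\<^sup>2) \<longlonglongrightarrow> K * 0\<^sup>2"
        by (intro tendsto_intros b_0)
      then show "(\<lambda>n. K * (b n)\<^sup>2) \<longlonglongrightarrow> 0" by simp
    qed
    moreover have "?I \<longlonglongrightarrow> (\<integral>x. f x \<partial>N)"
      using convX f unfolding weakly_converges_def by blast
    ultimately have "(\<lambda>n. (?J n - ?I n) + ?I n) \<longlonglongrightarrow> 0 + (\<integral>x. f x \<partial>N)" by (rule tendsto_add)
    then show "?J \<longlonglongrightarrow> (\<integral>x. f x \<partial>N)" by simp
  qed
  then show ?thesis using N unfolding converges_to_normal_def by blast
qed

end
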